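(* Consider the LED method in the server-workers setup described in the context and suppose the noise and smoothness assumptions stated there hold. Then, for every integer $R\ge1$, there exist parameters $\alpha,\beta,\gamma>0$ such that $$\frac1R\sum_{r=0}^{R-1}\mathcal E_r\le O\left(\frac{\sigma}{\sqrt{NR\tau}}+\frac{f(x^0)-f^\star+\varsigma_0^2}{R}\right),$$ where $O(\cdot)$ hides constants depending only on $L$ and $f(x^0)-f^\star$, and $$\mathcal E_r=\mathbb E\|\nabla f(x^r)\|^2+\frac1\tau\sum_{t=0}^{\tau-1}\mathbb E\Big\|\frac1N\sum_{i=1}^N\nabla f_i(\phi_{i,t}^r)\Big\|^2,\qquad \varsigma_0^2=\frac1N\sum_{i=1}^N\|\nabla f_i(x^0)-\nabla f(x^0)\|^2 .$$
   Context: Setting. There are $N\ge 1$ nodes (workers); node $i$ has $f_i:\mathbb R^m\to\mathbb R$, $f_i(x)=\mathbb E[F_i(x;\xi_i)]$, and $f=\frac1N\sum_{i=1}^N f_i$. LED in the server-workers setup. Parameters: an integer $\tau\ge1$ and $\alpha,\beta,\gamma>0$. Given a deterministic common $x^0\in\mathbb R^m$, set $y_i^0=0$ for all $i$. For $r=0,1,2,\dots$, each node $i$ sets $\phi_{i,0}^r=x^r$ and performs $$\phi_{i,t+1}^r=\phi_{i,t}^r-\alpha\nabla F_i(\phi_{i,t}^r;\xi_{i,t}^r)-\beta y_i^r\quad(t=0,\dots,\tau-1);$$ then $$x^{r+1}=(1-\gamma)x^r+\gamma\frac1N\sum_{j=1}^N\phi_{j,\tau}^r,\qquad y_i^{r+1}=y_i^r+\phi_{i,\tau}^r-\frac1N\sum_{j=1}^N\phi_{j,\tau}^r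 .$$ Noise assumption. For some $\sigma\ge0$ and all $i,r,t$, conditionally on everything generated before local step $t$ of round $r$, $\nabla F_i(\phi_{i,t}^r;\xi_{i,t}^r)$ has mean $\nabla f_i(\phi_{i,t}^r)$ and $\mathbb E\|\nabla F_i(\phi_{i,t}^r;\xi_{i,t}^r)-\nabla f_i(\phi_{i,t}^r)\|^2\le\sigma^2$; the samples $\xi_{i,t}^r$ are independent for all $i$, $t$ and $r$. Smoothness assumption. Each $f_i$ is differentiable and $\|\nabla f_i(y)-\nabla f_i(z)\|\le L\|y-z\|$ for all $y,z\in\mathbb R^m$, for some $L>0$; and $f$ is bounded below, with $f^\star=\inf f>-\infty$. *)

theory Defs
  imports "HOL-Probability.Probability"
begin

text \<open>
  Nodes are numbered \<open>0, \<dots>, N - 1\<close>, so that \<open>N\<close> is an ordinary natural number;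
  node-indexed data at indices \<open>i \<ge> N\<close> are never used.
\<close>

definition gradient :: "('a::real_inner \<Rightarrow> real) \<Rightarrow> 'a \<Rightarrow> 'a" where
  "gradient h x = (THE D. GDERIV h x :> D)"

definition avg :: "nat \<Rightarrow> (nat \<Rightarrow> 'a::real_vector) \<Rightarrow> 'a" where
  "avg N v = (1 / real N) *\<^sub>R (\<Sum>i<N. v i)"

definition global_obj :: "nat \<Rightarrow> (nat \<Rightarrow> 'a \<Rightarrow> real) \<Rightarrow> 'a \<Rightarrow> real" where
  "global_obj N f x = avg N (\<lambda>i. f i x)"

text \<open>
  The local objectives \<open>f i x = E[F i x \<xi>\<^sub>i]\<close>, where \<open>D i\<close> is the law of \<open>\<xi>\<^sub>i\<close>. Joint
  measurability of the stochastic gradients makes the iterates random variables; it is no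
  further restriction, as it follows from the integrability and differentiability of \<open>F i\<close> (a gradient is
  a limit of difference quotients of a function continuous in \<open>x\<close> and measurable in the sample).
\<close>

definition stochastic_objectives ::
  "nat \<Rightarrow> (nat \<Rightarrow> 's measure) \<Rightarrow> (nat \<Rightarrow> 'a::euclidean_space \<Rightarrow> 's \<Rightarrow> real) \<Rightarrow> (nat \<Rightarrow> 'a \<Rightarrow> real) \<Rightarrow> bool" where
  "stochastic_objectives N D F f \<longleftrightarrow>
     (\<forall>i<N. prob_space (D i) \<and>
        (\<forall>x. integrable (D i) (F i x) \<and> f i x = (\<integral>s. F i x s \<partial>D i)) \<and>
        (\<forall>s\<in>space (D i). \<forall>x. (\<lambda>v. F i v s) differentiable at x) \<and>
        (\<lambda>(x, s). gradient (\<lambda>v. F i v s) x) \<in> borel_measurable (borel \<Otimes>\<^sub>M D i))"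

definition smooth_objectives :: "nat \<Rightarrow> real \<Rightarrow> (nat \<Rightarrow> 'a::euclidean_space \<Rightarrow> real) \<Rightarrow> bool" where
  "smooth_objectives N L f \<longleftrightarrow>
     L > 0 \<and>
     (\<forall>i<N. (\<forall>x. f i differentiable at x) \<and>
        (\<forall>y z. norm (gradient (f i) y - gradient (f i) z) \<le> L * norm (y - z))) \<and>
     bdd_below (range (global_obj N f))"

text \<open>
  In the following, \<open>\<xi> i r t\<close> is the sample drawn by node \<open>i\<close> at local step \<open>t\<close> of round \<open>r\<close>,
  and \<open>x r\<close>, \<open>y i r\<close> and \<open>\<phi> i r t\<close> are the corresponding iterates, all as functions on the
  underlying probability space.
\<close>

definition led_run ::
  "'w measure \<Rightarrow> nat \<Rightarrow> nat \<Rightarrow> real \<Rightarrow> real \<Rightarrow> real \<Rightarrow> 'a::euclidean_space \<Rightarrow>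
   (nat \<Rightarrow> 'a \<Rightarrow> 's \<Rightarrow> real) \<Rightarrow> (nat \<Rightarrow> nat \<Rightarrow> nat \<Rightarrow> 'w \<Rightarrow> 's) \<Rightarrow>
   (nat \<Rightarrow> 'w \<Rightarrow> 'a) \<Rightarrow> (nat \<Rightarrow> nat \<Rightarrow> 'w \<Rightarrow> 'a) \<Rightarrow> (nat \<Rightarrow> nat \<Rightarrow> nat \<Rightarrow> 'w \<Rightarrow> 'a) \<Rightarrow> bool" where
  "led_run M N \<tau> \<alpha> \<beta> \<gamma> x0 F \<xi> x y \<phi> \<longleftrightarrow>
     (\<forall>\<omega>\<in>space M.
        x 0 \<omega> = x0 \<and>
        (\<forall>i<N. y i 0 \<omega> = 0) \<and>
        (\<forall>r. \<forall>i<N. \<phi> i r 0 \<omega> = x r \<omega>) \<and>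
        (\<forall>r. \<forall>i<N. \<forall>t<\<tau>.
           \<phi> i r (Suc t) \<omega> = \<phi> i r t \<omega>
             - \<alpha> *\<^sub>R gradient (\<lambda>v. F i v (\<xi> i r t \<omega>)) (\<phi> i r t \<omega>) - \<beta> *\<^sub>R y i r \<omega>) \<and>
        (\<forall>r. x (Suc r) \<omega> = (1 - \<gamma>) *\<^sub>R x r \<omega> + \<gamma> *\<^sub>R avg N (\<lambda>j. \<phi> j r \<tau> \<omega>)) \<and>
        (\<forall>r. \<forall>i<N. y i (Suc r) \<omega> = y i r \<omega> + \<phi> i r \<tau> \<omega> - avg N (\<lambda>j. \<phi> j r \<tau> \<omega>)))"

text \<open>
  The sigma-algebra of everything generated before local step \<open>t\<close> of round \<open>r\<close>: since \<open>x0\<close> is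
  deterministic, it is generated by the samples drawn before that step.
\<close>

definition history ::
  "'w measure \<Rightarrow> nat \<Rightarrow> nat \<Rightarrow> (nat \<Rightarrow> 's measure) \<Rightarrow> (nat \<Rightarrow> nat \<Rightarrow> nat \<Rightarrow> 'w \<Rightarrow> 's) \<Rightarrow> nat \<Rightarrow> nat \<Rightarrow> 'w measure" where
  "history M N \<tau> D \<xi> r t =
     sigma (space M)
       {\<xi> j q s -` A \<inter> space M | j q s A.
          j < N \<and> s < \<tau> \<and> (q < r \<or> q = r \<and> s < t) \<and> A \<in> sets (D j)}"

text \<open>
  The library has conditional expectations of real-valued functions only, so the conditional
  mean is taken coordinatewise; \<open>nn_cond_exp\<close> needs no integrability of the squared deviation.
\<close>

definition noise_assumption ::
  "'w measure \<Rightarrow> nat \<Rightarrow> nat \<Rightarrow> real \<Rightarrow> (nat \<Rightarrow> 's measure) \<Rightarrow> (nat \<Rightarrow> 'a::euclidean_space \<Rightarrow> 's \<Rightarrow> real) \<Rightarrow>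
   (nat \<Rightarrow> 'a \<Rightarrow> real) \<Rightarrow> (nat \<Rightarrow> nat \<Rightarrow> nat \<Rightarrow> 'w \<Rightarrow> 's) \<Rightarrow> (nat \<Rightarrow> nat \<Rightarrow> nat \<Rightarrow> 'w \<Rightarrow> 'a) \<Rightarrow> bool" where
  "noise_assumption M N \<tau> \<sigma> D F f \<xi> \<phi> \<longleftrightarrow>
     prob_space.indep_vars M (\<lambda>(i, r, t). D i) (\<lambda>(i, r, t). \<xi> i r t) ({..<N} \<times> UNIV \<times> {..<\<tau>}) \<and>
     (\<forall>i<N. \<forall>r. \<forall>t<\<tau>.
        let G = (\<lambda>\<omega>. gradient (\<lambda>v. F i v (\<xi> i r t \<omega>)) (\<phi> i r t \<omega>));
            H = history M N \<tau> D \<xi> r t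
        in integrable M G \<and>
           (\<forall>b\<in>Basis. AE \<omega> in M.
              real_cond_exp M H (\<lambda>\<omega>. G \<omega> \<bullet> b) \<omega> = gradient (f i) (\<phi> i r t \<omega>) \<bullet> b) \<and>
           (AE \<omega> in M.
              nn_cond_exp M H (\<lambda>\<omega>. ennreal ((norm (G \<omega> - gradient (f i) (\<phi> i r t \<omega>)))\<^sup>2)) \<omega>
                \<le> ennreal (\<sigma>\<^sup>2)))"

definition led_error ::
  "'w measure \<Rightarrow> nat \<Rightarrow> nat \<Rightarrow> (nat \<Rightarrow> 'a::euclidean_space \<Rightarrow> real) \<Rightarrow>
   (nat \<Rightarrow> 'w \<Rightarrow> 'a) \<Rightarrow> (nat \<Rightarrow> nat \<Rightarrow> nat \<Rightarrow> 'w \<Rightarrow> 'a) \<Rightarrow> nat \<Rightarrow> real" where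
  "led_error M N \<tau> f x \<phi> r =
     (\<integral>\<omega>. (norm (gradient (global_obj N f) (x r \<omega>)))\<^sup>2 \<partial>M)
     + (1 / real \<tau>) * (\<Sum>t<\<tau>. \<integral>\<omega>. (norm (avg N (\<lambda>i. gradient (f i) (\<phi> i r t \<omega>))))\<^sup>2 \<partial>M)"

definition heterogeneity :: "nat \<Rightarrow> (nat \<Rightarrow> 'a::euclidean_space \<Rightarrow> real) \<Rightarrow> 'a \<Rightarrow> real" where
  "heterogeneity N f x0 =
     avg N (\<lambda>i. (norm (gradient (f i) x0 - gradient (global_obj N f) x0))\<^sup>2)"

text \<open>
  The constant hidden in \<open>O(\<dots>)\<close>, as a function of \<open>L\<close> and the initial gap
  \<open>\<Delta> = f x0 - inf f\<close> alone. An existential quantifier inside the theorem would let the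
  constant depend on the type parameters, in particular on the dimension; a
  concrete function of \<open>L\<close> and \<open>\<Delta>\<close> cannot. The factor 100 is not optimised.
\<close>

definition rate_const :: "real \<Rightarrow> real \<Rightarrow> real" where
  "rate_const L \<Delta> = 100 * (1 + L) * (1 + \<Delta>)"

end

theory Submission
  imports Defs
begin

text \<open>
  With \<open>\<beta> = 1\<close>, \<open>\<gamma> = \<eta> / (\<alpha> \<tau>)\<close> and \<open>\<alpha>\<close> tiny, the corrections \<open>y i\<close> and the local drift
  \<open>\<phi> i r t - x r\<close> are of order \<open>\<alpha>\<close>, so that LED is a perturbation of minibatch stochastic gradient
  descent with step size \<open>\<eta>\<close> and batch size \<open>N \<tau>\<close>: the corrections average to zero, hence
  \<open>x (r + 1) = x r - \<eta> (mean gradient + mean error)\<close>, and the mean error has variance at most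
  \<open>\<sigma>\<^sup>2 / (N \<tau>)\<close>. The descent lemma gives an average error of order
  \<open>\<Delta> / (\<eta> R) + L \<eta> \<sigma>\<^sup>2 / (N \<tau>) + drift\<close>, and \<open>\<eta> = 1 / (2 L + \<sigma> \<surd>(R / (N \<tau>)))\<close> balances the first two
  terms. The drift is bounded by \<open>\<alpha>\<^sup>2 C S\<close> with \<open>S = \<sigma>\<^sup>2 + (\<Sum>i<N. (norm (\<nabla>f\<^sub>i x0))\<^sup>2)\<close> and \<open>C\<close> independent of
  \<open>\<alpha>\<close>. If the target bound vanishes, then \<open>x0\<close> is a stationary point of every \<open>f i\<close> and there is no
  noise, so \<open>S = 0\<close>; otherwise a small \<open>\<alpha>\<close> makes the drift negligible.
\<close>

section \<open>Smooth objectives\<close>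

text \<open>Since \<open>gradient\<close> is a definite description, it is useless until existence
  and uniqueness are known. Existence is the Riesz representation of the derivative in coordinates;
  uniqueness is that of the Frechet derivative.\<close>

lemma GDERIV_gradient:
  fixes h :: "'a::euclidean_space \<Rightarrow> real"
  assumes "h differentiable at x"
  shows "GDERIV h x :> gradient h x"
proof -
  obtain h' where h': "(h has_derivative h') (at x)"
    using assms by (auto simp: differentiable_def)
  interpret bounded_linear h'
    using h' by (rule has_derivative_bounded_linear)
  define G where "G = (\<Sum>b\<in>Basis. h' b *\<^sub>R b)"
  have "h' v = v \<bullet> G" for v
  proof -
    have "h' v = h' (\<Sum>b\<in>Basis. (v \<bullet> b) *\<^sub>R b)"
      by (simp add: euclidean_representation)
    also have "\<dots> = v \<bullet> G"
      by (simp add: sum scaleR G_def inner_sum_right mult.commute)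
    finally show ?thesis .
  qed
  then have h'_eq: "h' = (\<lambda>v. v \<bullet> G)" ..
  have G: "GDERIV h x :> G"
    using h' unfolding gderiv_def h'_eq .
  show ?thesis
    unfolding gradient_def
  proof (rule theI)
    show "GDERIV h x :> G" by fact
    fix D
    assume "GDERIV h x :> D"
    then have "(\<lambda>v. v \<bullet> D) = (\<lambda>v. v \<bullet> G)"
      using G unfolding gderiv_def by (rule has_derivative_unique)
    then show "D = G"
      by (metis vector_eq_ldot inner_commute)
  qed
qed

lemma gradient_eqI:
  fixes h :: "'a::euclidean_space \<Rightarrow> real"
  assumes "GDERIV h x :> D"
  shows "gradient h x = D"
proof -
  have "h differentiable at x"
    using assms by (auto simp: gderiv_def differentiable_def)
  then have "GDERIV h x :> gradient h x"
    by (rule GDERIV_gradient)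
  then have "(\<lambda>v. v \<bullet> D) = (\<lambda>v. v \<bullet> gradient h x)"
    using assms unfolding gderiv_def by (metis has_derivative_unique)
  then show ?thesis
    by (metis vector_eq_ldot inner_commute)
qed

lemma gradient_eq_0_of_minimum:
  fixes h :: "'a::euclidean_space \<Rightarrow> real"
  assumes "h differentiable at x" and "\<And>v. h x \<le> h v"
  shows "gradient h x = 0"
proof -
  have "(h has_derivative (\<lambda>v. v \<bullet> gradient h x)) (at x)"
    using GDERIV_gradient[OF assms(1)] by (simp add: gderiv_def)
  then have "(\<lambda>v. v \<bullet> gradient h x) = (\<lambda>v. 0)"
    by (rule has_derivative_local_min) (simp add: assms(2))
  then show ?thesis
    by (metis inner_eq_zero_iff)
qed

text \<open>The quadratic upper bound behind every descent argument. No integration along the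
  segment is needed: the gap \<open>p\<close> between the two sides has nonpositive derivative on
  [0, 1], by Cauchy-Schwarz and the Lipschitz bound, so \<open>p 1 \<le> p 0\<close>.\<close>

lemma smooth_upper_bound:
  fixes h :: "'a::euclidean_space \<Rightarrow> real"
  assumes diff: "\<And>v. h differentiable at v"
    and lip: "\<And>v w. norm (gradient h v - gradient h w) \<le> L * norm (v - w)"
  shows "h (x + d) \<le> h x + gradient h x \<bullet> d + L / 2 * (norm d)\<^sup>2"
proof -
  define p where "p t = h (x + t *\<^sub>R d) - t * (gradient h x \<bullet> d) - L / 2 * t\<^sup>2 * (norm d)\<^sup>2" for t
  define p' where "p' t = gradient h (x + t *\<^sub>R d) \<bullet> d - gradient h x \<bullet> d - L * t * (norm d)\<^sup>2" for t
  have der: "(p has_real_derivative p' t) (at t)" for t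
  proof -
    have "(h has_derivative (\<lambda>v. v \<bullet> gradient h (x + t *\<^sub>R d))) (at (x + t *\<^sub>R d))"
      using GDERIV_gradient[OF diff] by (simp add: gderiv_def)
    then have "((\<lambda>t. h (x + t *\<^sub>R d)) has_derivative
        (\<lambda>s. (s *\<^sub>R d) \<bullet> gradient h (x + t *\<^sub>R d))) (at t)"
      by (rule has_derivative_compose[rotated]) (auto intro!: derivative_eq_intros)
    then have "((\<lambda>t. h (x + t *\<^sub>R d)) has_real_derivative
        gradient h (x + t *\<^sub>R d) \<bullet> d) (at t)"
      by (rule has_derivative_imp_has_field_derivative) (simp add: inner_commute mult.commute)
    then show ?thesis
      unfolding p_def[abs_def] p'_def by (auto intro!: derivative_eq_intros)
  qed
  have "p 1 \<le> p 0"
  proof (rule DERIV_nonpos_imp_nonincreasing[of 0 1 p])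
    fix t :: real
    assume t: "0 \<le> t" "t \<le> 1"
    have "gradient h (x + t *\<^sub>R d) \<bullet> d - gradient h x \<bullet> d
        \<le> norm (gradient h (x + t *\<^sub>R d) - gradient h x) * norm d"
      by (metis inner_diff_left norm_cauchy_schwarz)
    also have "\<dots> \<le> (L * norm (t *\<^sub>R d)) * norm d"
      using lip[of "x + t *\<^sub>R d" x] by (intro mult_right_mono) auto
    also have "\<dots> = L * t * (norm d)\<^sup>2"
      using t by (simp add: power2_eq_square)
    finally show "\<exists>y. (p has_real_derivative y) (at t) \<and> y \<le> 0"
      using der[of t] by (intro exI[of _ "p' t"]) (simp add: p'_def)
  qed simp
  then show ?thesis
    by (simp add: p_def)
qed

section \<open>Averages and inequalities for squared norms\<close>

lemma avg_const: "N \<ge> 1 \<Longrightarrow> avg N (\<lambda>i. v) = v"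
  by (simp add: avg_def sum_constant_scaleR)

lemma avg_diff: "avg N (\<lambda>i. u i - v i) = avg N u - avg N v"
  by (simp add: avg_def sum_subtractf scaleR_diff_right)

lemma avg_add: "avg N (\<lambda>i. u i + v i) = avg N u + avg N v"
  by (simp add: avg_def sum.distrib scaleR_add_right)

lemma avg_scaleR: "avg N (\<lambda>i. c *\<^sub>R v i) = c *\<^sub>R avg N v"
  by (simp add: avg_def scaleR_sum_right[symmetric] mult.commute)

lemma avg_mono:
  fixes u v :: "nat \<Rightarrow> real"
  shows "(\<And>i. i < N \<Longrightarrow> u i \<le> v i) \<Longrightarrow> avg N u \<le> avg N v"
  by (auto simp: avg_def intro!: divide_right_mono sum_mono)

lemma avg_cong: "(\<And>i. i < N \<Longrightarrow> u i = v i) \<Longrightarrow> avg N u = avg N v"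
  by (simp add: avg_def)

lemma norm_sum_square_le:
  fixes v :: "nat \<Rightarrow> 'a::real_inner"
  shows "(norm (\<Sum>i<N. v i))\<^sup>2 \<le> real N * (\<Sum>i<N. (norm (v i))\<^sup>2)"
proof -
  have "(norm (\<Sum>i<N. v i))\<^sup>2 \<le> (\<Sum>i<N. norm (v i))\<^sup>2"
    by (intro power_mono norm_sum) simp
  also have "\<dots> \<le> real N * (\<Sum>i<N. (norm (v i))\<^sup>2)"
    using Cauchy_Schwarz_ineq_sum[of "\<lambda>_. 1" "\<lambda>i. norm (v i)" "{..<N}"] by simp
  finally show ?thesis .
qed

lemma norm_avg_square_le:
  fixes v :: "nat \<Rightarrow> 'a::real_inner"
  shows "(norm (avg N v))\<^sup>2 \<le> avg N (\<lambda>i. (norm (v i))\<^sup>2)"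
proof (cases "N = 0")
  case False
  then show ?thesis
    using norm_sum_square_le[of v N]
    by (simp add: avg_def power_divide field_simps power2_eq_square)
qed (simp add: avg_def)

lemma norm_add_square_le:
  fixes u v :: "'a::real_inner"
  shows "(norm (u + v))\<^sup>2 \<le> 2 * (norm u)\<^sup>2 + 2 * (norm v)\<^sup>2"
  using norm_sum_square_le[where N = 2 and v = "\<lambda>i. if i = 0 then u else v"]
  by (simp add: numeral_2_eq_2)

lemma norm_add3_square_le:
  fixes u v w :: "'a::real_inner"
  shows "(norm (u + v + w))\<^sup>2 \<le> 3 * (norm u)\<^sup>2 + 3 * (norm v)\<^sup>2 + 3 * (norm w)\<^sup>2"
  using norm_sum_square_le[where N = 3 and v = "\<lambda>i. if i = 0 then u else if i = 1 then v else w"]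
  by (simp add: numeral_3_eq_3 add_ac)

lemma GDERIV_avg:
  assumes "\<And>i. i < N \<Longrightarrow> GDERIV (f i) x :> D i"
  shows "GDERIV (\<lambda>v. avg N (\<lambda>i. f i v)) x :> avg N D"
proof -
  have "((\<lambda>v. \<Sum>i<N. f i v) has_derivative (\<lambda>v. \<Sum>i<N. v \<bullet> D i)) (at x)"
    using assms by (intro has_derivative_sum) (auto simp: gderiv_def)
  from has_derivative_scaleR_right[OF this, of "1 / real N"] show ?thesis
    by (simp add: gderiv_def avg_def inner_sum_right)
qed

section \<open>Square-integrable random vectors\<close>

text \<open>Measurability and integrability are bundled with the bound, because the integral of a
  non-integrable function is 0 by default and a bound on it alone would carry no
  information.\<close>

definition L2_le :: "'w measure \<Rightarrow> ('w \<Rightarrow> 'a::euclidean_space) \<Rightarrow> real \<Rightarrow> bool" where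
  "L2_le M X c \<longleftrightarrow> X \<in> borel_measurable M \<and> integrable M (\<lambda>\<omega>. (norm (X \<omega>))\<^sup>2) \<and>
     (\<integral>\<omega>. (norm (X \<omega>))\<^sup>2 \<partial>M) \<le> c"

lemma L2_leD:
  assumes "L2_le M X c"
  shows "X \<in> borel_measurable M" "integrable M (\<lambda>\<omega>. (norm (X \<omega>))\<^sup>2)"
    "(\<integral>\<omega>. (norm (X \<omega>))\<^sup>2 \<partial>M) \<le> c"
  using assms by (auto simp: L2_le_def)

lemma L2_le_dominated:
  assumes X: "X \<in> borel_measurable M" and g: "integrable M g"
    and le: "\<And>\<omega>. \<omega> \<in> space M \<Longrightarrow> (norm (X \<omega>))\<^sup>2 \<le> g \<omega>" and c: "(\<integral>\<omega>. g \<omega> \<partial>M) \<le> c"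
  shows "L2_le M X c"
proof -
  have "integrable M (\<lambda>\<omega>. (norm (X \<omega>))\<^sup>2)"
    using g by (rule Bochner_Integration.integrable_bound)
      (use X le in \<open>auto intro!: AE_I2 order_trans[OF le abs_ge_self]\<close>)
  moreover from this g have "(\<integral>\<omega>. (norm (X \<omega>))\<^sup>2 \<partial>M) \<le> (\<integral>\<omega>. g \<omega> \<partial>M)"
    by (rule integral_mono) (rule le)
  ultimately show ?thesis
    using X c by (auto simp: L2_le_def)
qed

lemma L2_le_mono: "L2_le M X c \<Longrightarrow> c \<le> d \<Longrightarrow> L2_le M X d"
  by (auto simp: L2_le_def)

lemma L2_le_cong:
  assumes "\<And>\<omega>. \<omega> \<in> space M \<Longrightarrow> X \<omega> = Y \<omega>"
  shows "L2_le M X c \<longleftrightarrow> L2_le M Y c"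
proof -
  have "X \<in> borel_measurable M \<longleftrightarrow> Y \<in> borel_measurable M"
    by (intro measurable_cong assms)
  moreover have "integrable M (\<lambda>\<omega>. (norm (X \<omega>))\<^sup>2) \<longleftrightarrow> integrable M (\<lambda>\<omega>. (norm (Y \<omega>))\<^sup>2)"
    by (intro Bochner_Integration.integrable_cong) (auto simp: assms)
  moreover have "(\<integral>\<omega>. (norm (X \<omega>))\<^sup>2 \<partial>M) = (\<integral>\<omega>. (norm (Y \<omega>))\<^sup>2 \<partial>M)"
    by (intro Bochner_Integration.integral_cong) (auto simp: assms)
  ultimately show ?thesis
    by (simp add: L2_le_def)
qed

lemma L2_le_add:
  assumes X: "L2_le M X a" and Y: "L2_le M Y b"
  shows "L2_le M (\<lambda>\<omega>. X \<omega> + Y \<omega>) (2 * a + 2 * b)"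
proof (rule L2_le_dominated)
  show "(norm (X \<omega> + Y \<omega>))\<^sup>2 \<le> 2 * (norm (X \<omega>))\<^sup>2 + 2 * (norm (Y \<omega>))\<^sup>2" for \<omega>
    by (rule norm_add_square_le)
qed (use L2_leD[OF X] L2_leD[OF Y] in auto)

lemma L2_le_add3:
  assumes X: "L2_le M X a" and Y: "L2_le M Y b" and Z: "L2_le M Z c"
  shows "L2_le M (\<lambda>\<omega>. X \<omega> + Y \<omega> + Z \<omega>) (3 * a + 3 * b + 3 * c)"
proof (rule L2_le_dominated)
  show "(norm (X \<omega> + Y \<omega> + Z \<omega>))\<^sup>2
      \<le> 3 * (norm (X \<omega>))\<^sup>2 + 3 * (norm (Y \<omega>))\<^sup>2 + 3 * (norm (Z \<omega>))\<^sup>2" for \<omega>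
    by (rule norm_add3_square_le)
qed (use L2_leD[OF X] L2_leD[OF Y] L2_leD[OF Z] in auto)

lemma L2_le_scaleR:
  assumes "L2_le M X a"
  shows "L2_le M (\<lambda>\<omega>. c *\<^sub>R X \<omega>) (c\<^sup>2 * a)"
  using L2_leD[OF assms] by (auto simp: L2_le_def power_mult_distrib mult_left_mono)

lemma L2_le_avg:
  assumes X: "\<And>i. i < N \<Longrightarrow> L2_le M (X i) (c i)"
  shows "L2_le M (\<lambda>\<omega>. avg N (\<lambda>i. X i \<omega>)) (avg N c)"
proof (rule L2_le_dominated)
  have [measurable]: "X i \<in> borel_measurable M" if "i < N" for i
    using L2_leD(1)[OF X[OF that]] .
  show "(\<lambda>\<omega>. avg N (\<lambda>i. X i \<omega>)) \<in> borel_measurable M"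
    unfolding avg_def by measurable
  show "(norm (avg N (\<lambda>i. X i \<omega>)))\<^sup>2 \<le> avg N (\<lambda>i. (norm (X i \<omega>))\<^sup>2)" for \<omega>
    by (rule norm_avg_square_le)
  show "integrable M (\<lambda>\<omega>. avg N (\<lambda>i. (norm (X i \<omega>))\<^sup>2))"
    unfolding avg_def by (auto intro!: Bochner_Integration.integrable_sum L2_leD[OF X])
  have "(\<integral>\<omega>. avg N (\<lambda>i. (norm (X i \<omega>))\<^sup>2) \<partial>M) = avg N (\<lambda>i. \<integral>\<omega>. (norm (X i \<omega>))\<^sup>2 \<partial>M)"
    unfolding avg_def by (simp add: L2_leD[OF X])
  also have "\<dots> \<le> avg N c"
    by (intro avg_mono L2_leD[OF X])
  finally show "(\<integral>\<omega>. avg N (\<lambda>i. (norm (X i \<omega>))\<^sup>2) \<partial>M) \<le> avg N c" .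
qed

lemma (in prob_space) L2_le_const: "L2_le M (\<lambda>\<omega>. v) ((norm v)\<^sup>2)"
  by (simp add: L2_le_def prob_space)

lemma L2_le_integrable_inner:
  assumes X: "L2_le M X a" and Y: "L2_le M Y b"
  shows "integrable M (\<lambda>\<omega>. X \<omega> \<bullet> Y \<omega>)"
proof (rule Bochner_Integration.integrable_bound)
  show "integrable M (\<lambda>\<omega>. (norm (X \<omega>))\<^sup>2 + (norm (Y \<omega>))\<^sup>2)"
    using L2_leD[OF X] L2_leD[OF Y] by auto
  show "(\<lambda>\<omega>. X \<omega> \<bullet> Y \<omega>) \<in> borel_measurable M"
    using L2_leD(1)[OF X] L2_leD(1)[OF Y] by measurable
  have "norm (X \<omega> \<bullet> Y \<omega>) \<le> norm ((norm (X \<omega>))\<^sup>2 + (norm (Y \<omega>))\<^sup>2)" for \<omega>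
    using Cauchy_Schwarz_ineq2[of "X \<omega>" "Y \<omega>"] sum_squares_bound[of "norm (X \<omega>)" "norm (Y \<omega>)"]
      mult_nonneg_nonneg[OF norm_ge_zero[of "X \<omega>"] norm_ge_zero[of "Y \<omega>"]]
    by auto
  then show "AE \<omega> in M. norm (X \<omega> \<bullet> Y \<omega>) \<le> norm ((norm (X \<omega>))\<^sup>2 + (norm (Y \<omega>))\<^sup>2)"
    by simp
qed

lemma (in prob_space) L2_le_integrable:
  assumes "L2_le M X a"
  shows "integrable M X"
proof (rule Bochner_Integration.integrable_bound)
  show "integrable M (\<lambda>\<omega>. 1 + (norm (X \<omega>))\<^sup>2)"
    using L2_leD[OF assms] by auto
  have "norm (X \<omega>) \<le> norm (1 + (norm (X \<omega>))\<^sup>2)" for \<omega>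
    using sum_squares_bound[of 1 "norm (X \<omega>)"] norm_ge_zero[of "X \<omega>"]
    unfolding real_norm_def by (simp; linarith)
  then show "AE \<omega> in M. norm (X \<omega>) \<le> norm (1 + (norm (X \<omega>))\<^sup>2)"
    by simp
qed (rule L2_leD(1)[OF assms])

text \<open>Vanishing integrals over all sets of \<open>K\<close> say that each coordinate of
  \<open>n\<close> has conditional expectation zero given \<open>K\<close>, and a
  \<open>K\<close>-measurable factor can be pulled out. Working coordinatewise reduces the claim to
  real-valued conditional expectations.\<close>

lemma (in prob_space) integral_inner_eq_0:
  assumes sub: "subalgebra M K" and Z: "Z \<in> borel_measurable K"
    and n: "integrable M n" and nZ: "\<And>b. b \<in> Basis \<Longrightarrow> integrable M (\<lambda>\<omega>. (Z \<omega> \<bullet> b) * (n \<omega> \<bullet> b))"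
    and zero: "\<And>A b. A \<in> sets K \<Longrightarrow> b \<in> Basis \<Longrightarrow> (\<integral>\<omega>\<in>A. n \<omega> \<bullet> b \<partial>M) = 0"
  shows "(\<integral>\<omega>. Z \<omega> \<bullet> n \<omega> \<partial>M) = 0"
proof -
  interpret finite_measure_subalgebra M K
    by unfold_locales (rule sub)
  have coord: "(\<integral>\<omega>. (Z \<omega> \<bullet> b) * (n \<omega> \<bullet> b) \<partial>M) = 0" if b: "b \<in> Basis" for b
  proof -
    have n_b: "integrable M (\<lambda>\<omega>. n \<omega> \<bullet> b)"
      using n by simp
    have "AE \<omega> in M. real_cond_exp M K (\<lambda>\<omega>. n \<omega> \<bullet> b) \<omega> = 0"
      by (rule real_cond_exp_charact) (use zero[OF _ b] n_b in auto)
    then have "(\<integral>\<omega>. (Z \<omega> \<bullet> b) * real_cond_exp M K (\<lambda>\<omega>. n \<omega> \<bullet> b) \<omega> \<partial>M) = (\<integral>\<omega>. 0 \<partial>M)"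
      by (intro integral_cong_AE)
        (use measurable_from_subalg[OF sub Z] in auto)
    moreover have "(\<integral>\<omega>. (Z \<omega> \<bullet> b) * real_cond_exp M K (\<lambda>\<omega>. n \<omega> \<bullet> b) \<omega> \<partial>M)
        = (\<integral>\<omega>. (Z \<omega> \<bullet> b) * (n \<omega> \<bullet> b) \<partial>M)"
      by (rule real_cond_exp_intg(2)) (use Z n_b nZ[OF b] in auto)
    ultimately show ?thesis
      by simp
  qed
  have "(\<integral>\<omega>. Z \<omega> \<bullet> n \<omega> \<partial>M) = (\<integral>\<omega>. (\<Sum>b\<in>Basis. (Z \<omega> \<bullet> b) * (n \<omega> \<bullet> b)) \<partial>M)"
    by (simp add: euclidean_inner[symmetric])
  also have "\<dots> = (\<Sum>b\<in>Basis. \<integral>\<omega>. (Z \<omega> \<bullet> b) * (n \<omega> \<bullet> b) \<partial>M)"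
    by (rule Bochner_Integration.integral_sum) (rule nZ)
  finally show ?thesis
    using coord by simp
qed

text \<open>
  This makes the errors of different nodes in the same local step orthogonal, although the noise
  assumption only conditions on the earlier steps.
\<close>

lemma (in prob_space) set_integral_eq_0_indep:
  fixes X :: "'a \<Rightarrow> real"
  assumes X: "integrable M X" and X_K: "X \<in> borel_measurable K"
    and HK: "sets H \<subseteq> sets K" and spH: "space H = space M" and spK: "space K = space M"
    and spK': "space K' = space M"
    and indep: "indep_set (sets K) (sets K')"
    and zero: "\<And>A. A \<in> sets H \<Longrightarrow> (\<integral>\<omega>\<in>A. X \<omega> \<partial>M) = 0"
    and A: "A \<in> sigma_sets (space M) (sets H \<union> sets K')"
  shows "(\<integral>\<omega>\<in>A. X \<omega> \<partial>M) = 0"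
proof -
  have KM: "sets K \<subseteq> events" and KM': "sets K' \<subseteq> events"
    using indep by (auto simp: indep_sets2_eq)
  have set_int: "set_integrable M B X" if "B \<in> events" for B
    unfolding set_integrable_def by (rule integrable_mult_indicator[OF that X])
  \<comment> \<open>These intersections form a pi-system that contains both \<open>sets H\<close>
    and \<open>sets K'\<close>, so Dynkin's theorem reduces the claim to a single
    \<open>h \<inter> B\<close>.\<close>
  define P where "P = {h \<inter> B | h B. h \<in> sets H \<and> B \<in> sets K'}"
  have stable: "Int_stable P"
  proof (rule Int_stableI)
    fix a b
    assume "a \<in> P" "b \<in> P"
    then obtain h B h' B' where "a = h \<inter> B" "b = h' \<inter> B'"
      "h \<in> sets H" "h' \<in> sets H" "B \<in> sets K'" "B' \<in> sets K'"
      by (auto simp: P_def)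
    then have "a \<inter> b = (h \<inter> h') \<inter> (B \<inter> B')" "h \<inter> h' \<in> sets H" "B \<inter> B' \<in> sets K'"
      by auto
    then show "a \<inter> b \<in> P"
      unfolding P_def by blast
  qed
  have P_events: "P \<subseteq> events"
    using HK KM KM' by (auto simp: P_def)
  then have P_Pow: "P \<subseteq> Pow (space M)"
    using sets.space_closed by blast
  have sigP: "sigma_sets (space M) P \<subseteq> events"
    using P_events by (rule sets.sigma_sets_subset)
  have "sets H \<union> sets K' \<subseteq> P"
  proof
    fix a
    assume "a \<in> sets H \<union> sets K'"
    then show "a \<in> P"
    proof
      assume a: "a \<in> sets H"
      then have "a = a \<inter> space K'"
        using sets.sets_into_space[OF a] by (auto simp: spK' spH)
      then show ?thesis
        using a unfolding P_def by blast
    next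
      assume a: "a \<in> sets K'"
      then have "a = space H \<inter> a"
        using sets.sets_into_space[OF a] by (auto simp: spK' spH)
      then show ?thesis
        using a unfolding P_def by blast
    qed
  qed
  then have A_P: "A \<in> sigma_sets (space M) P"
    using A sigma_sets_mono'[of "sets H \<union> sets K'" P "space M"] by auto
  show ?thesis
    using stable P_Pow A_P
  proof (induction rule: sigma_sets_induct_disjoint)
    case (basic a)
    then obtain h B where a: "a = h \<inter> B" and h: "h \<in> sets H" and B: "B \<in> sets K'"
      by (auto simp: P_def)
    let ?X = "\<lambda>\<omega>. indicator h \<omega> * X \<omega>" and ?Y = "indicator B :: 'a \<Rightarrow> real"
    have hM: "h \<in> events" and BM: "B \<in> events"
      using h B HK KM KM' by auto
    have X_h: "?X \<in> borel_measurable K"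
      using h HK X_K by (intro borel_measurable_times) auto
    have int_h: "integrable M ?X"
      using integrable_mult_indicator[OF hM X] by simp
    \<comment> \<open>The factor containing \<open>X\<close> lives in \<open>K\<close> and the
      indicator of \<open>B\<close> in \<open>K'\<close>. The integral over
      \<open>h \<inter> B\<close> therefore factorises, and its first factor is zero by
      assumption.\<close>
    have "indep_var borel ?X borel ?Y"
      unfolding indep_var_eq
    proof safe
      show "random_variable borel ?X"
        using int_h by auto
      show "random_variable borel ?Y"
        using BM by auto
      have 1: "sigma_sets (space M) {?X -` A \<inter> space M |A. A \<in> sets borel} \<subseteq> sets K"
        unfolding spK[symmetric] by (rule sets.sigma_sets_subset) (auto intro: measurable_sets[OF X_h])
      have Y_K: "?Y \<in> borel_measurable K'"
        using B by auto
      have 2: "sigma_sets (space M) {?Y -` A \<inter> space M |A. A \<in> sets borel} \<subseteq> sets K'"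
        unfolding spK'[symmetric] by (rule sets.sigma_sets_subset) (auto intro: measurable_sets[OF Y_K])
      show "indep_set (sigma_sets (space M) {?X -` A \<inter> space M |A. A \<in> sets borel})
          (sigma_sets (space M) {?Y -` A \<inter> space M |A. A \<in> sets borel})"
        using indep 1 2 unfolding indep_sets2_eq by blast
    qed
    then have "(\<integral>\<omega>. ?X \<omega> * ?Y \<omega> \<partial>M) = (\<integral>\<omega>. ?X \<omega> \<partial>M) * (\<integral>\<omega>. ?Y \<omega> \<partial>M)"
      using int_h BM by (intro indep_var_lebesgue_integral) (auto simp: emeasure_eq_measure)
    also have "(\<integral>\<omega>. ?X \<omega> \<partial>M) = 0"
      using zero[OF h] by (simp add: set_lebesgue_integral_def)
    finally show ?case
      by (simp add: a set_lebesgue_integral_def indicator_inter_arith mult_ac)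
  next
    case empty
    show ?case
      by (simp add: set_lebesgue_integral_def)
  next
    case (compl a)
    have "a \<in> events"
      using compl sigP by auto
    have "(\<integral>\<omega>\<in>space M. X \<omega> \<partial>M) = 0"
      using zero[OF sets.top[of H]] by (simp add: spH)
    moreover have "(\<integral>\<omega>\<in>space M. X \<omega> \<partial>M) = (\<integral>\<omega>\<in>(space M - a) \<union> a. X \<omega> \<partial>M)"
      using sets.sets_into_space[OF \<open>a \<in> events\<close>] by (simp add: Un_absorb2)
    moreover have "\<dots> = (\<integral>\<omega>\<in>space M - a. X \<omega> \<partial>M) + (\<integral>\<omega>\<in>a. X \<omega> \<partial>M)"
      using \<open>a \<in> events\<close>
      by (intro set_integral_Un set_int) auto
    ultimately show ?case
      using compl by simp
  next
    case (union B)
    have BM: "B i \<in> events" for i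
      using union sigP by auto
    have "set_lebesgue_integral M (\<Union>i. B i) X = (\<Sum>i. set_lebesgue_integral M (B i) X)"
      using union(1) BM
      by (intro lebesgue_integral_countable_add set_int) (auto simp: disjoint_family_on_def)
    then show ?case
      using union by simp
  qed
qed

lemma norm_avg_le: "norm (avg N v) \<le> avg N (\<lambda>i. norm (v i))"
  using norm_sum[of v "{..<N}"] by (simp add: avg_def divide_right_mono)

section \<open>The averaged objective and its gradient\<close>

locale smooth_sum =
  fixes N :: nat and L :: real and f :: "nat \<Rightarrow> 'a::euclidean_space \<Rightarrow> real"
  assumes N: "N \<ge> 1" and smooth: "smooth_objectives N L f"
begin

lemma L_pos: "L > 0"
  using smooth by (simp add: smooth_objectives_def)

lemma gradient_lipschitz:
  "i < N \<Longrightarrow> norm (gradient (f i) v - gradient (f i) w) \<le> L * norm (v - w)"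
  using smooth by (simp add: smooth_objectives_def)

lemma GDERIV_global:
  "GDERIV (global_obj N f) v :> avg N (\<lambda>i. gradient (f i) v)"
  unfolding global_obj_def[abs_def] using smooth
  by (intro GDERIV_avg GDERIV_gradient) (simp add: smooth_objectives_def)

lemma gradient_global: "gradient (global_obj N f) v = avg N (\<lambda>i. gradient (f i) v)"
  by (rule gradient_eqI[OF GDERIV_global])

lemma differentiable_global: "global_obj N f differentiable at v"
  using GDERIV_global by (auto simp: gderiv_def differentiable_def)

lemma global_lipschitz:
  "norm (gradient (global_obj N f) v - gradient (global_obj N f) w) \<le> L * norm (v - w)"
proof -
  have "norm (gradient (global_obj N f) v - gradient (global_obj N f) w)
      \<le> avg N (\<lambda>i. norm (gradient (f i) v - gradient (f i) w))"
    unfolding gradient_global avg_diff[symmetric] by (rule norm_avg_le)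
  also have "\<dots> \<le> avg N (\<lambda>i. L * norm (v - w))"
    by (intro avg_mono gradient_lipschitz)
  finally show ?thesis
    using N by (simp add: avg_const)
qed

lemma global_upper_bound:
  "global_obj N f (v + d)
     \<le> global_obj N f v + gradient (global_obj N f) v \<bullet> d + L / 2 * (norm d)\<^sup>2"
  by (intro smooth_upper_bound differentiable_global global_lipschitz)

lemma lipschitz_measurable:
  fixes g :: "'a \<Rightarrow> 'a"
  assumes "\<And>v w. norm (g v - g w) \<le> L * norm (v - w)"
  shows "g \<in> borel_measurable borel"
proof (rule borel_measurable_continuous_onI)
  have "L-lipschitz_on UNIV g"
    using L_pos assms by (auto simp: lipschitz_on_def dist_norm)
  then show "continuous_on UNIV g"
    by (rule lipschitz_on_continuous_on)
qed

lemma gradient_measurable: "i < N \<Longrightarrow> gradient (f i) \<in> borel_measurable borel"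
  by (intro lipschitz_measurable gradient_lipschitz)

lemma gradient_global_measurable [measurable]:
  "gradient (global_obj N f) \<in> borel_measurable borel"
  by (intro lipschitz_measurable global_lipschitz)

lemma global_measurable [measurable]: "global_obj N f \<in> borel_measurable borel"
  using differentiable_global
  by (intro borel_measurable_continuous_onI)
    (auto simp: continuous_on_eq_continuous_at intro: differentiable_imp_continuous_within)

lemma global_lower_bound: "(INF v. global_obj N f v) \<le> global_obj N f v"
  using smooth by (intro cINF_lower) (auto simp: smooth_objectives_def)

end

section \<open>The LED process\<close>

text \<open>
  The two recursions bound the squared \<open>L\<^sup>2\<close> norms of the local drift (divided by \<open>\<alpha>\<^sup>2\<close>) and of
  \<open>x r - x0\<close> and \<open>y i r / \<alpha>\<close>, all relative to \<open>S\<close>; here \<open>k\<close> is the moment bound at the start of the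
  round and \<open>h = \<gamma> \<alpha>\<close>. They depend on \<open>\<alpha>\<close> only through \<open>h\<close>, which stays fixed as \<open>\<alpha>\<close> shrinks.
\<close>

primrec drift_bound :: "real \<Rightarrow> real \<Rightarrow> nat \<Rightarrow> real" where
  "drift_bound L k 0 = 0"
| "drift_bound L k (Suc t) =
     3 * drift_bound L k t + 3 * (6 + 6 * L\<^sup>2 * (drift_bound L k t + k)) + 3 * k"

primrec moment_bound :: "real \<Rightarrow> nat \<Rightarrow> real \<Rightarrow> nat \<Rightarrow> real" where
  "moment_bound L \<tau> h 0 = 0"
| "moment_bound L \<tau> h (Suc r) =
     3 * moment_bound L \<tau> h r + (6 + 2 * h\<^sup>2) * drift_bound L (moment_bound L \<tau> h r) \<tau>"

lemma drift_bound_nonneg: "k \<ge> 0 \<Longrightarrow> drift_bound L k t \<ge> 0"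
  by (induction t) auto

lemma moment_bound_nonneg: "moment_bound L \<tau> h r \<ge> 0"
  by (induction r) (auto intro!: add_nonneg_nonneg mult_nonneg_nonneg drift_bound_nonneg)

text \<open>The value \<beta> = 1 is built into the run. The restriction \<alpha> \<le> 1 lets terms
  of order \<alpha>^2 be absorbed into bounds of order one when the distance to \<open>x0\<close> is
  estimated.\<close>

locale led_process = prob_space M + smooth_sum N L f
  for M :: "'w measure" and N :: nat and L :: real
    and f :: "nat \<Rightarrow> 'a::euclidean_space \<Rightarrow> real" +
  fixes \<tau> :: nat and \<alpha> \<gamma> \<sigma> :: real and D :: "nat \<Rightarrow> 's measure"
    and F :: "nat \<Rightarrow> 'a \<Rightarrow> 's \<Rightarrow> real" and x0 :: 'a
    and \<xi> :: "nat \<Rightarrow> nat \<Rightarrow> nat \<Rightarrow> 'w \<Rightarrow> 's"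
    and x :: "nat \<Rightarrow> 'w \<Rightarrow> 'a" and y :: "nat \<Rightarrow> nat \<Rightarrow> 'w \<Rightarrow> 'a"
    and \<phi> :: "nat \<Rightarrow> nat \<Rightarrow> nat \<Rightarrow> 'w \<Rightarrow> 'a"
  assumes \<tau>: "\<tau> \<ge> 1" and \<alpha>: "0 < \<alpha>" "\<alpha> \<le> 1" and \<gamma>: "\<gamma> > 0"
    and objectives: "stochastic_objectives N D F f"
    and run: "led_run M N \<tau> \<alpha> 1 \<gamma> x0 F \<xi> x y \<phi>"
    and noise: "noise_assumption M N \<tau> \<sigma> D F f \<xi> \<phi>"
begin

section \<open>The sigma-algebras generated by the samples\<close>

definition steps :: "(nat \<times> nat \<times> nat) set" where
  "steps = {..<N} \<times> UNIV \<times> {..<\<tau>}"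

text \<open>Steps are ordered lexicographically by round and local step, simultaneously for all
  nodes; samples of other nodes at the same local step are thus not part of the past.\<close>

definition past :: "nat \<Rightarrow> nat \<Rightarrow> (nat \<times> nat \<times> nat) set" where
  "past r t = {(j, q, s). j < N \<and> s < \<tau> \<and> (q < r \<or> q = r \<and> s < t)}"

definition events_of :: "nat \<times> nat \<times> nat \<Rightarrow> 'w set set" where
  "events_of = (\<lambda>(j, q, s). {\<xi> j q s -` A \<inter> space M | A. A \<in> sets (D j)})"

text \<open>Arbitrary index sets are allowed, not only pasts, so that simultaneous samples of other
  nodes can be adjoined to a past and split off again by independence.\<close>

definition generated :: "(nat \<times> nat \<times> nat) set \<Rightarrow> 'w measure" where
  "generated I = sigma (space M) (\<Union>k\<in>I. events_of k)"

lemma indep_steps: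
  "indep_vars (\<lambda>(i, r, t). D i) (\<lambda>(i, r, t). \<xi> i r t) steps"
  using noise by (simp add: noise_assumption_def steps_def)

lemma \<xi>_random: "(i, r, t) \<in> steps \<Longrightarrow> random_variable (D i) (\<xi> i r t)"
  using indep_steps unfolding indep_vars_def by fastforce

lemma events_of_Pow: "(\<Union>k\<in>I. events_of k) \<subseteq> Pow (space M)"
  by (auto simp: events_of_def)

lemma space_generated [simp]: "space (generated I) = space M"
  using events_of_Pow by (simp add: generated_def)

lemma sets_generated: "sets (generated I) = sigma_sets (space M) (\<Union>k\<in>I. events_of k)"
  using events_of_Pow by (simp add: generated_def)

lemma sets_generated_mono: "I \<subseteq> J \<Longrightarrow> sets (generated I) \<subseteq> sets (generated J)"
  unfolding sets_generated by (intro sigma_sets_mono') blast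

lemma subalgebra_generated:
  assumes "I \<subseteq> steps"
  shows "subalgebra M (generated I)"
proof -
  have "(\<Union>k\<in>I. events_of k) \<subseteq> events"
    using assms \<xi>_random by (fastforce simp: events_of_def intro: measurable_sets)
  then show ?thesis
    unfolding subalgebra_def sets_generated by (simp add: sets.sigma_sets_subset)
qed

lemma measurable_generated_mono:
  "g \<in> measurable (generated I) M' \<Longrightarrow> I \<subseteq> J \<Longrightarrow> g \<in> measurable (generated J) M'"
  using sets_generated_mono[of I J] unfolding measurable_def by auto

lemma \<xi>_measurable:
  assumes "I \<subseteq> steps" "(i, r, t) \<in> I"
  shows "\<xi> i r t \<in> measurable (generated I) (D i)"
proof (rule measurableI)
  show "\<xi> i r t \<omega> \<in> space (D i)" if "\<omega> \<in> space (generated I)" for \<omega>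
    using \<xi>_random[of i r t] assms that by (auto dest: measurable_space)
  show "\<xi> i r t -` A \<inter> space (generated I) \<in> sets (generated I)" if "A \<in> sets (D i)" for A
    using assms that unfolding sets_generated
    by (intro sigma_sets.Basic) (force simp: events_of_def)
qed

text \<open>Independence of the single samples passes to disjoint blocks of samples, because the
  preimages under one sample form an intersection-stable family. \<open>case_bool I J\<close>
  encodes the partition into two blocks.\<close>

lemma indep_generated:
  assumes "I \<inter> J = {}" "I \<subseteq> steps" "J \<subseteq> steps"
  shows "indep_set (sets (generated I)) (sets (generated J))"
proof -
  have "indep_sets events_of steps"
    using indep_steps unfolding indep_vars_def2
    by (simp add: events_of_def case_prod_unfold)
  then have "indep_sets events_of (\<Union>b\<in>UNIV. case_bool I J b)"
    by (rule indep_sets_mono_index[rotated]) (use assms in \<open>auto split: bool.splits\<close>)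
  then have "indep_sets (\<lambda>b. sigma_sets (space M) (\<Union>k\<in>case_bool I J b. events_of k)) UNIV"
  proof (rule indep_sets_collect_sigma)
    show "Int_stable (events_of k)" for k
    proof (cases k)
      case (fields j q s)
      show ?thesis
      proof (rule Int_stableI)
        fix a b
        assume "a \<in> events_of k" "b \<in> events_of k"
        then obtain A B where AB: "A \<in> sets (D j)" "B \<in> sets (D j)"
          "a = \<xi> j q s -` A \<inter> space M" "b = \<xi> j q s -` B \<inter> space M"
          by (auto simp: events_of_def fields)
        then show "a \<inter> b \<in> events_of k"
          unfolding events_of_def fields by (auto intro!: exI[of _ "A \<inter> B"])
      qed
    qed
    show "disjoint_family_on (case_bool I J) UNIV"
      using assms(1) by (auto simp: disjoint_family_on_def split: bool.splits)
  qed
  then show ?thesis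
    unfolding indep_set_def sets_generated
    by (rule back_subst[of "\<lambda>G. indep_sets G UNIV"]) (auto simp: fun_eq_iff split: bool.splits)
qed

text \<open>This brings a past enlarged by further samples into the form to which
  \<open>set_integral_eq_0_indep\<close> applies.\<close>

lemma sets_generated_Un:
  "sets (generated (I \<union> J)) \<subseteq> sigma_sets (space M) (sets (generated I) \<union> sets (generated J))"
  unfolding sets_generated[of "I \<union> J"]
proof (rule sigma_sets_mono)
  show "(\<Union>k\<in>I \<union> J. events_of k) \<subseteq> sigma_sets (space M) (sets (generated I) \<union> sets (generated J))"
    unfolding sets_generated by (blast intro: sigma_sets.Basic)
qed

lemma history_eq: "history M N \<tau> D \<xi> r t = generated (past r t)"
proof -
  have "{\<xi> j q s -` A \<inter> space M | j q s A.
      j < N \<and> s < \<tau> \<and> (q < r \<or> q = r \<and> s < t) \<and> A \<in> sets (D j)} = (\<Union>k\<in>past r t. events_of k)"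
    by (fastforce simp: past_def events_of_def)
  then show ?thesis
    by (simp add: history_def generated_def)
qed

lemma past_steps: "past r t \<subseteq> steps"
  by (auto simp: past_def steps_def)

lemma past_mono: "q < r \<or> q = r \<and> s \<le> t \<Longrightarrow> past q s \<subseteq> past r t"
  by (auto simp: past_def)

lemma past_Suc: "past r \<tau> = past (Suc r) 0"
  by (auto simp: past_def less_Suc_eq)

section \<open>Stochastic gradients, their errors and adaptedness of the iterates\<close>

definition sgrad :: "nat \<Rightarrow> nat \<Rightarrow> nat \<Rightarrow> 'w \<Rightarrow> 'a" where
  "sgrad i r t \<omega> = gradient (\<lambda>v. F i v (\<xi> i r t \<omega>)) (\<phi> i r t \<omega>)"

definition err :: "nat \<Rightarrow> nat \<Rightarrow> nat \<Rightarrow> 'w \<Rightarrow> 'a" where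
  "err i r t \<omega> = sgrad i r t \<omega> - gradient (f i) (\<phi> i r t \<omega>)"

lemma run_0: "\<omega> \<in> space M \<Longrightarrow> x 0 \<omega> = x0"
    "\<omega> \<in> space M \<Longrightarrow> i < N \<Longrightarrow> y i 0 \<omega> = 0"
    "\<omega> \<in> space M \<Longrightarrow> i < N \<Longrightarrow> \<phi> i r 0 \<omega> = x r \<omega>"
  and run_Suc: "\<omega> \<in> space M \<Longrightarrow> i < N \<Longrightarrow> t < \<tau> \<Longrightarrow>
      \<phi> i r (Suc t) \<omega> = \<phi> i r t \<omega> - \<alpha> *\<^sub>R sgrad i r t \<omega> - y i r \<omega>"
    "\<omega> \<in> space M \<Longrightarrow> x (Suc r) \<omega> = (1 - \<gamma>) *\<^sub>R x r \<omega> + \<gamma> *\<^sub>R avg N (\<lambda>j. \<phi> j r \<tau> \<omega>)"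
    "\<omega> \<in> space M \<Longrightarrow> i < N \<Longrightarrow>
      y i (Suc r) \<omega> = y i r \<omega> + \<phi> i r \<tau> \<omega> - avg N (\<lambda>j. \<phi> j r \<tau> \<omega>)"
  using run by (auto simp: led_run_def sgrad_def)

lemma sgrad_measurable:
  assumes "i < N" "I \<subseteq> steps" "(i, r, t) \<in> I" and \<phi>: "\<phi> i r t \<in> borel_measurable (generated I)"
  shows "sgrad i r t \<in> borel_measurable (generated I)"
proof -
  have F: "(\<lambda>(v, s). gradient (\<lambda>v. F i v s) v) \<in> borel_measurable (borel \<Otimes>\<^sub>M D i)"
    using objectives \<open>i < N\<close> by (simp add: stochastic_objectives_def)
  have "(\<lambda>\<omega>. (\<phi> i r t \<omega>, \<xi> i r t \<omega>)) \<in> measurable (generated I) (borel \<Otimes>\<^sub>M D i)"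
    using \<phi> \<xi>_measurable[OF assms(2,3)] by (rule measurable_Pair)
  from measurable_compose[OF this F] show ?thesis
    by (simp add: sgrad_def[abs_def])
qed

text \<open>The inner half of a nested induction: adaptedness of \<open>x r\<close> and of the
  corrections is a hypothesis here and is supplied by the induction over rounds in
  \<open>round_measurable\<close>. Each local step uses one further sample, which is why the past
  grows from \<open>t\<close> to \<open>Suc t\<close>.\<close>

lemma \<phi>_measurable_round:
  assumes x: "x r \<in> borel_measurable (generated (past r 0))"
    and y: "\<And>i. i < N \<Longrightarrow> y i r \<in> borel_measurable (generated (past r 0))"
    and "i < N" "t \<le> \<tau>"
  shows "\<phi> i r t \<in> borel_measurable (generated (past r t))"
  using \<open>t \<le> \<tau>\<close>
proof (induction t)
  case 0
  have "x r \<in> borel_measurable (generated (past r 0)) \<longleftrightarrow>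
      \<phi> i r 0 \<in> borel_measurable (generated (past r 0))"
    using \<open>i < N\<close> by (intro measurable_cong) (simp add: run_0)
  then show ?case
    using x by simp
next
  case (Suc t)
  let ?H = "generated (past r (Suc t))"
  have \<phi> [measurable]: "\<phi> i r t \<in> borel_measurable ?H"
    by (rule measurable_generated_mono) (use Suc past_mono[of r r t "Suc t"] in auto)
  have [measurable]: "y i r \<in> borel_measurable ?H"
    by (rule measurable_generated_mono) (use y \<open>i < N\<close> past_mono[of r r 0 "Suc t"] in auto)
  have [measurable]: "sgrad i r t \<in> borel_measurable ?H"
    by (rule sgrad_measurable[OF \<open>i < N\<close> past_steps _ \<phi>])
      (use \<open>i < N\<close> Suc.prems in \<open>auto simp: past_def\<close>)
  have "\<phi> i r (Suc t) \<in> borel_measurable ?H \<longleftrightarrow>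
      (\<lambda>\<omega>. \<phi> i r t \<omega> - \<alpha> *\<^sub>R sgrad i r t \<omega> - y i r \<omega>) \<in> borel_measurable ?H"
    using \<open>i < N\<close> Suc.prems by (intro measurable_cong) (simp add: run_Suc)
  moreover have "(\<lambda>\<omega>. \<phi> i r t \<omega> - \<alpha> *\<^sub>R sgrad i r t \<omega> - y i r \<omega>) \<in> borel_measurable ?H"
    by measurable
  ultimately show ?case
    by simp
qed

lemma round_measurable:
  "x r \<in> borel_measurable (generated (past r 0)) \<and>
   (\<forall>i<N. y i r \<in> borel_measurable (generated (past r 0)))"
proof (induction r)
  case 0
  have "x 0 \<in> borel_measurable (generated (past 0 0)) \<longleftrightarrow>
      (\<lambda>\<omega>. x0) \<in> borel_measurable (generated (past 0 0))"
    by (intro measurable_cong) (simp add: run_0)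
  moreover have "y i 0 \<in> borel_measurable (generated (past 0 0)) \<longleftrightarrow>
      (\<lambda>\<omega>. 0 :: 'a) \<in> borel_measurable (generated (past 0 0))" if "i < N" for i
    using that by (intro measurable_cong) (simp add: run_0)
  ultimately show ?case
    by simp
next
  case (Suc r)
  let ?H = "generated (past (Suc r) 0)"
  have sub: "past r 0 \<subseteq> past (Suc r) 0"
    by (intro past_mono) simp
  have [measurable]: "x r \<in> borel_measurable ?H"
    using Suc sub by (blast intro: measurable_generated_mono)
  have y [measurable]: "y i r \<in> borel_measurable ?H" if "i < N" for i
    using Suc sub that by (blast intro: measurable_generated_mono)
  have \<phi> [measurable]: "\<phi> i r \<tau> \<in> borel_measurable ?H" if "i < N" for i
    using \<phi>_measurable_round[of r i \<tau>] Suc that by (simp add: past_Suc)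
  have avg [measurable]: "(\<lambda>\<omega>. avg N (\<lambda>j. \<phi> j r \<tau> \<omega>)) \<in> borel_measurable ?H"
    unfolding avg_def by measurable
  have "x (Suc r) \<in> borel_measurable ?H \<longleftrightarrow>
      (\<lambda>\<omega>. (1 - \<gamma>) *\<^sub>R x r \<omega> + \<gamma> *\<^sub>R avg N (\<lambda>j. \<phi> j r \<tau> \<omega>)) \<in> borel_measurable ?H"
    by (intro measurable_cong) (simp add: run_Suc)
  moreover have "(\<lambda>\<omega>. (1 - \<gamma>) *\<^sub>R x r \<omega> + \<gamma> *\<^sub>R avg N (\<lambda>j. \<phi> j r \<tau> \<omega>)) \<in> borel_measurable ?H"
    by measurable
  moreover have "y i (Suc r) \<in> borel_measurable ?H" if "i < N" for i
  proof -
    have "y i (Suc r) \<in> borel_measurable ?H \<longleftrightarrow>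
        (\<lambda>\<omega>. y i r \<omega> + \<phi> i r \<tau> \<omega> - avg N (\<lambda>j. \<phi> j r \<tau> \<omega>)) \<in> borel_measurable ?H"
      using that by (intro measurable_cong) (simp add: run_Suc)
    moreover have "(\<lambda>\<omega>. y i r \<omega> + \<phi> i r \<tau> \<omega> - avg N (\<lambda>j. \<phi> j r \<tau> \<omega>)) \<in> borel_measurable ?H"
      using y[OF that] \<phi>[OF that] avg by measurable
    ultimately show ?thesis
      by simp
  qed
  ultimately show ?case
    by simp
qed

lemma x_measurable: "x r \<in> borel_measurable (generated (past r 0))"
  using round_measurable by blast

lemma \<phi>_measurable: "i < N \<Longrightarrow> t \<le> \<tau> \<Longrightarrow> \<phi> i r t \<in> borel_measurable (generated (past r t))"
  using round_measurable by (intro \<phi>_measurable_round) auto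

lemma err_measurable:
  assumes "i < N" "t < \<tau>" "I \<subseteq> steps" "(i, r, t) \<in> I" "past r t \<subseteq> I"
  shows "err i r t \<in> borel_measurable (generated I)"
proof -
  have [measurable]: "\<phi> i r t \<in> borel_measurable (generated I)"
    using \<phi>_measurable[of i t r] assms by (auto intro: measurable_generated_mono)
  have [measurable]: "sgrad i r t \<in> borel_measurable (generated I)"
    using assms by (intro sgrad_measurable) auto
  have [measurable]: "gradient (f i) \<in> borel_measurable borel"
    using assms by (intro gradient_measurable)
  show ?thesis
    unfolding err_def[abs_def] by measurable
qed

section \<open>Second moments and orthogonality of the gradient errors\<close>

lemma measurable_generatedD:
  "g \<in> borel_measurable (generated I) \<Longrightarrow> I \<subseteq> steps \<Longrightarrow> g \<in> borel_measurable M"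
  by (rule measurable_from_subalg[OF subalgebra_generated])

text \<open>The conditional variance bound is integrated in the extended nonnegative reals, where no
  integrability has to be known beforehand. Finiteness of the result then yields integrability, and
  only afterwards is the bound moved to the real integral.\<close>

lemma err_L2:
  assumes "i < N" "t < \<tau>"
  shows "L2_le M (err i r t) (\<sigma>\<^sup>2)"
proof -
  interpret H: finite_measure_subalgebra M "generated (past r t)"
    by unfold_locales (rule subalgebra_generated[OF past_steps])
  have [measurable]: "err i r t \<in> borel_measurable M"
    by (rule measurable_generatedD[OF err_measurable[where I = steps]])
      (use assms past_steps in \<open>auto simp: steps_def\<close>)
  let ?e = "\<lambda>\<omega>. ennreal ((norm (err i r t \<omega>))\<^sup>2)"
  have "AE \<omega> in M. nn_cond_exp M (generated (past r t)) ?e \<omega> \<le> ennreal (\<sigma>\<^sup>2)"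
    using noise assms unfolding noise_assumption_def Let_def history_eq err_def sgrad_def by blast
  then have "(\<integral>\<^sup>+\<omega>. 1 * nn_cond_exp M (generated (past r t)) ?e \<omega> \<partial>M) \<le> (\<integral>\<^sup>+\<omega>. ennreal (\<sigma>\<^sup>2) \<partial>M)"
    by (intro nn_integral_mono_AE) auto
  also have "(\<integral>\<^sup>+\<omega>. 1 * nn_cond_exp M (generated (past r t)) ?e \<omega> \<partial>M) = (\<integral>\<^sup>+\<omega>. 1 * ?e \<omega> \<partial>M)"
    by (rule H.nn_cond_exp_intg) auto
  finally have le: "(\<integral>\<^sup>+\<omega>. ?e \<omega> \<partial>M) \<le> ennreal (\<sigma>\<^sup>2)"
    by (simp add: emeasure_space_1)
  have int: "integrable M (\<lambda>\<omega>. (norm (err i r t \<omega>))\<^sup>2)"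
    using le by (intro integrableI_bounded) (auto intro: le_less_trans)
  have "ennreal (\<integral>\<omega>. (norm (err i r t \<omega>))\<^sup>2 \<partial>M) \<le> ennreal (\<sigma>\<^sup>2)"
    using le by (subst nn_integral_eq_integral[OF int, symmetric]) auto
  then show ?thesis
    using int by (simp add: L2_le_def)
qed

lemma err_cond_mean:
  assumes "i < N" "t < \<tau>" "A \<in> sets (generated (past r t))" "b \<in> Basis"
  shows "(\<integral>\<omega>\<in>A. err i r t \<omega> \<bullet> b \<partial>M) = 0"
proof -
  interpret H: finite_measure_subalgebra M "generated (past r t)"
    by unfold_locales (rule subalgebra_generated[OF past_steps])
  have G: "integrable M (sgrad i r t)"
    and mean: "AE \<omega> in M. real_cond_exp M (generated (past r t)) (\<lambda>\<omega>. sgrad i r t \<omega> \<bullet> b) \<omega>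
        = gradient (f i) (\<phi> i r t \<omega>) \<bullet> b"
    using noise assms unfolding noise_assumption_def Let_def history_eq err_def sgrad_def by auto
  \<comment> \<open>Integrability of the true gradient along the run is not among the assumptions;
    it follows because this gradient is the stochastic gradient minus its square-integrable
    error.\<close>
  have "integrable M (\<lambda>\<omega>. sgrad i r t \<omega> - err i r t \<omega>)"
    using G L2_le_integrable[OF err_L2] assms by auto
  then have g: "integrable M (\<lambda>\<omega>. gradient (f i) (\<phi> i r t \<omega>))"
    by (simp add: err_def)
  have A: "A \<in> events"
    using assms(3) subalgebra_generated[OF past_steps] by (auto simp: subalgebra_def)
  have set_int: "set_integrable M A h" if "integrable M h" for h :: "'w \<Rightarrow> real"
    unfolding set_integrable_def by (rule integrable_mult_indicator[OF A that])
  have "(\<integral>\<omega>\<in>A. sgrad i r t \<omega> \<bullet> b \<partial>M)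
      = (\<integral>\<omega>\<in>A. real_cond_exp M (generated (past r t)) (\<lambda>\<omega>. sgrad i r t \<omega> \<bullet> b) \<omega> \<partial>M)"
    using G assms(3) by (intro H.real_cond_exp_intA) auto
  also have "\<dots> = (\<integral>\<omega>\<in>A. gradient (f i) (\<phi> i r t \<omega>) \<bullet> b \<partial>M)"
    unfolding set_lebesgue_integral_def
  proof (rule integral_cong_AE)
    show "(\<lambda>\<omega>. indicat_real A \<omega> *\<^sub>R (gradient (f i) (\<phi> i r t \<omega>) \<bullet> b)) \<in> borel_measurable M"
      using g A by (intro borel_measurable_scaleR borel_measurable_inner) auto
  qed (use mean A in auto)
  finally show ?thesis
    using set_int[of "\<lambda>\<omega>. sgrad i r t \<omega> \<bullet> b"] set_int[of "\<lambda>\<omega>. gradient (f i) (\<phi> i r t \<omega>) \<bullet> b"] G g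
    by (simp add: err_def inner_diff_left)
qed

text \<open>The error has mean zero given the past. The samples in \<open>J\<close> are independent
  of the past together with the current sample, so it still has mean zero once \<open>J\<close> is
  adjoined, and \<open>Z\<close> is measurable with respect to that larger sigma-algebra.\<close>

lemma err_orthogonal:
  assumes i: "i < N" and t: "t < \<tau>"
    and J: "J \<subseteq> steps" "J \<inter> insert (i, r, t) (past r t) = {}"
    and Z: "Z \<in> borel_measurable (generated (past r t \<union> J))" "L2_le M Z c"
  shows "(\<integral>\<omega>. Z \<omega> \<bullet> err i r t \<omega> \<partial>M) = 0"
proof (rule integral_inner_eq_0)
  let ?I = "insert (i, r, t) (past r t)"
  have I: "?I \<subseteq> steps"
    using past_steps i t by (auto simp: steps_def)
  show "subalgebra M (generated (past r t \<union> J))"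
    using J past_steps by (intro subalgebra_generated) auto
  show "Z \<in> borel_measurable (generated (past r t \<union> J))"
    by (rule Z)
  show e: "integrable M (err i r t)"
    by (rule L2_le_integrable[OF err_L2[OF i t]])
  show "integrable M (\<lambda>\<omega>. (Z \<omega> \<bullet> b) * (err i r t \<omega> \<bullet> b))" if "b \<in> Basis" for b
  proof -
    have coord: "L2_le M (\<lambda>\<omega>. X \<omega> \<bullet> b) d" if X: "L2_le M X d" for X :: "'w \<Rightarrow> 'a" and d
    proof (rule L2_le_dominated)
      show "(norm (X \<omega> \<bullet> b))\<^sup>2 \<le> (norm (X \<omega>))\<^sup>2" for \<omega>
        using Basis_le_norm[OF \<open>b \<in> Basis\<close>, of "X \<omega>"] by (simp add: abs_le_square_iff[symmetric])
    qed (use L2_leD[OF X] in auto)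
    show ?thesis
      using L2_le_integrable_inner[OF coord[OF Z(2)] coord[OF err_L2[OF i t, of r]]] by simp
  qed
  fix A and b :: 'a
  assume A: "A \<in> sets (generated (past r t \<union> J))" and b: "b \<in> Basis"
  show "(\<integral>\<omega>\<in>A. err i r t \<omega> \<bullet> b \<partial>M) = 0"
  proof (rule set_integral_eq_0_indep)
    show "integrable M (\<lambda>\<omega>. err i r t \<omega> \<bullet> b)"
      using e by simp
    show "(\<lambda>\<omega>. err i r t \<omega> \<bullet> b) \<in> borel_measurable (generated ?I)"
      using err_measurable[OF i t I, of r] by (auto simp: subset_insertI)
    show "sets (generated (past r t)) \<subseteq> sets (generated ?I)"
      by (intro sets_generated_mono) auto
    show "indep_set (sets (generated ?I)) (sets (generated J))"
      using J I by (intro indep_generated) auto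
    show "A \<in> sigma_sets (space M) (sets (generated (past r t)) \<union> sets (generated J))"
      using A sets_generated_Un by blast
    show "(\<integral>\<omega>\<in>B. err i r t \<omega> \<bullet> b \<partial>M) = 0" if "B \<in> sets (generated (past r t))" for B
      by (rule err_cond_mean[OF i t that b])
  qed simp_all
qed

end

section \<open>Sums of orthogonal vectors and the pointwise descent inequality\<close>

lemma avg_swap: "avg N (\<lambda>i. avg K (\<lambda>t. v i t)) = avg K (\<lambda>t. avg N (\<lambda>i. v i t))"
  by (simp add: avg_def scaleR_sum_right[symmetric] mult.commute sum.swap[of v "{..<K}"])

text \<open>The off-diagonal terms of the expanded square integrate to zero. Hence the factor is
  \<open>card A\<close> and not its square, which is the source of the speedup in the number of
  nodes and local steps.\<close>

lemma L2_le_sum_orthogonal: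
  assumes A: "finite A" and X: "\<And>a. a \<in> A \<Longrightarrow> L2_le M (X a) c"
    and orth: "\<And>a b. a \<in> A \<Longrightarrow> b \<in> A \<Longrightarrow> a \<noteq> b \<Longrightarrow> (\<integral>\<omega>. X a \<omega> \<bullet> X b \<omega> \<partial>M) = 0"
  shows "L2_le M (\<lambda>\<omega>. \<Sum>a\<in>A. X a \<omega>) (real (card A) * c)"
proof (rule L2_le_dominated)
  let ?g = "\<lambda>\<omega>. \<Sum>a\<in>A. \<Sum>b\<in>A. X a \<omega> \<bullet> X b \<omega>"
  show "(\<lambda>\<omega>. \<Sum>a\<in>A. X a \<omega>) \<in> borel_measurable M"
    using L2_leD(1)[OF X] by (intro borel_measurable_sum)
  have int: "integrable M (\<lambda>\<omega>. X a \<omega> \<bullet> X b \<omega>)" if "a \<in> A" "b \<in> A" for a b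
    using L2_le_integrable_inner[OF X X] that .
  show "integrable M ?g"
    by (intro Bochner_Integration.integrable_sum int)
  show "(norm (\<Sum>a\<in>A. X a \<omega>))\<^sup>2 \<le> ?g \<omega>" for \<omega>
    by (simp add: power2_norm_eq_inner inner_sum_left) (simp add: inner_sum_right)
  have "(\<integral>\<omega>. ?g \<omega> \<partial>M) = (\<Sum>a\<in>A. \<Sum>b\<in>A. \<integral>\<omega>. X a \<omega> \<bullet> X b \<omega> \<partial>M)"
    by (simp add: Bochner_Integration.integral_sum Bochner_Integration.integrable_sum int)
  also have "\<dots> = (\<Sum>a\<in>A. \<Sum>b\<in>A. if b = a then \<integral>\<omega>. (norm (X a \<omega>))\<^sup>2 \<partial>M else 0)"
    using orth by (intro sum.cong refl) (auto simp: power2_norm_eq_inner)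
  also have "\<dots> = (\<Sum>a\<in>A. \<integral>\<omega>. (norm (X a \<omega>))\<^sup>2 \<partial>M)"
    using A by simp
  also have "\<dots> \<le> real (card A) * c"
    by (intro sum_bounded_above L2_leD(3)[OF X])
  finally show "(\<integral>\<omega>. ?g \<omega> \<partial>M) \<le> real (card A) * c" .
qed

context smooth_sum
begin

text \<open>Here \<open>g\<close> plays the role of the mean gradient of a round and
  \<open>n\<close> that of its mean error. The error is paired linearly only with the gradient at
  \<open>v\<close>: later local gradients depend on earlier errors of the same round, so
  \<open>g\<close> need not be orthogonal to \<open>n\<close>, and \<open>g + n\<close> is split by
  a square inequality instead.\<close>

lemma descent_pointwise:
  assumes "0 \<le> \<eta>" "\<eta> \<le> 1 / (2 * L)"
  shows "global_obj N f (v - \<eta> *\<^sub>R (g + n)) \<le> global_obj N f v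
    - \<eta> / 2 * (norm (gradient (global_obj N f) v))\<^sup>2
    + \<eta> / 2 * (norm (g - gradient (global_obj N f) v))\<^sup>2
    - \<eta> * (gradient (global_obj N f) v \<bullet> n) + L * \<eta>\<^sup>2 * (norm n)\<^sup>2"
proof -
  let ?G = "gradient (global_obj N f) v"
  have "global_obj N f (v - \<eta> *\<^sub>R (g + n))
      \<le> global_obj N f v - \<eta> * (?G \<bullet> g) - \<eta> * (?G \<bullet> n) + L / 2 * \<eta>\<^sup>2 * (norm (g + n))\<^sup>2"
    using global_upper_bound[of v "- (\<eta> *\<^sub>R (g + n))"]
    by (simp add: inner_add_right power_mult_distrib distrib_left)
  moreover have "L / 2 * \<eta>\<^sup>2 * (norm (g + n))\<^sup>2
      \<le> L / 2 * \<eta>\<^sup>2 * (2 * (norm g)\<^sup>2 + 2 * (norm n)\<^sup>2)"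
    using L_pos by (intro mult_left_mono norm_add_square_le) auto
  \<comment> \<open>The limit on the step size enters here: the smoothness term in \<open>g\<close>
    is cancelled by the square of \<open>g\<close> that the polarisation identity below
    provides.\<close>
  moreover have "L * \<eta>\<^sup>2 * (norm g)\<^sup>2 \<le> \<eta> / 2 * (norm g)\<^sup>2"
  proof (rule mult_right_mono)
    have "(L * \<eta>) * \<eta> \<le> 1 / 2 * \<eta>"
      using assms L_pos by (intro mult_right_mono) (auto simp: field_simps)
    then show "L * \<eta>\<^sup>2 \<le> \<eta> / 2"
      by (simp add: power2_eq_square)
  qed simp
  moreover have "\<eta> * (?G \<bullet> g)
      = \<eta> / 2 * (norm ?G)\<^sup>2 + \<eta> / 2 * (norm g)\<^sup>2 - \<eta> / 2 * (norm (g - ?G))\<^sup>2"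
    by (simp add: power2_norm_eq_inner inner_diff_left inner_diff_right inner_commute algebra_simps)
  ultimately show ?thesis
    by (simp add: algebra_simps)
qed

lemma gradient_diff_L2:
  assumes i: "i < N" and [measurable]: "u \<in> borel_measurable M" "v \<in> borel_measurable M"
    and c: "L2_le M (\<lambda>\<omega>. u \<omega> - v \<omega>) c"
  shows "L2_le M (\<lambda>\<omega>. gradient (f i) (u \<omega>) - gradient (f i) (v \<omega>)) (L\<^sup>2 * c)"
proof (rule L2_le_dominated)
  note [measurable] = gradient_measurable[OF i]
  show "(\<lambda>\<omega>. gradient (f i) (u \<omega>) - gradient (f i) (v \<omega>)) \<in> borel_measurable M"
    by measurable
  show "(norm (gradient (f i) (u \<omega>) - gradient (f i) (v \<omega>)))\<^sup>2 \<le> L\<^sup>2 * (norm (u \<omega> - v \<omega>))\<^sup>2" for \<omega>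
    unfolding power_mult_distrib[symmetric] by (intro power_mono gradient_lipschitz i) simp
  show "integrable M (\<lambda>\<omega>. L\<^sup>2 * (norm (u \<omega> - v \<omega>))\<^sup>2)"
    using L2_leD(2)[OF c] by simp
  show "(\<integral>\<omega>. L\<^sup>2 * (norm (u \<omega> - v \<omega>))\<^sup>2 \<partial>M) \<le> L\<^sup>2 * c"
    using L2_leD(3)[OF c] by (simp add: mult_left_mono)
qed

text \<open>The objective lies between its infimum and the quadratic upper bound around
  \<open>v\<close>, so a second moment of \<open>u\<close> around \<open>v\<close> suffices.\<close>

lemma global_integrable:
  assumes "prob_space M" and [measurable]: "u \<in> borel_measurable M"
    and c: "L2_le M (\<lambda>\<omega>. u \<omega> - v) c"
  shows "integrable M (\<lambda>\<omega>. global_obj N f (u \<omega>))"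
proof (rule Bochner_Integration.integrable_bound)
  interpret prob_space M by fact
  let ?G = "gradient (global_obj N f) v" and ?m = "INF w. global_obj N f w"
  let ?g = "\<lambda>\<omega>. \<bar>?m\<bar> + \<bar>global_obj N f v\<bar> + (norm ?G)\<^sup>2 + (1 + L) * (norm (u \<omega> - v))\<^sup>2"
  show "integrable M ?g"
    using L2_leD(2)[OF c] by auto
  show "(\<lambda>\<omega>. global_obj N f (u \<omega>)) \<in> borel_measurable M"
    by measurable
  have "norm (global_obj N f (u \<omega>)) \<le> norm (?g \<omega>)" for \<omega>
  proof -
    let ?d = "u \<omega> - v"
    have "global_obj N f (u \<omega>) \<le> global_obj N f v + ?G \<bullet> ?d + L / 2 * (norm ?d)\<^sup>2"
      using global_upper_bound[of v ?d] by simp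
    also have "?G \<bullet> ?d \<le> (norm ?G)\<^sup>2 + (norm ?d)\<^sup>2"
      using norm_cauchy_schwarz[of ?G ?d] sum_squares_bound[of "norm ?G" "norm ?d"]
        mult_nonneg_nonneg[OF norm_ge_zero[of ?G] norm_ge_zero[of ?d]] by linarith
    finally have "global_obj N f (u \<omega>)
        \<le> global_obj N f v + (norm ?G)\<^sup>2 + (norm ?d)\<^sup>2 + L / 2 * (norm ?d)\<^sup>2"
      by simp
    moreover have "?m \<le> global_obj N f (u \<omega>)"
      by (rule global_lower_bound)
    moreover have "0 \<le> (norm ?G)\<^sup>2" "0 \<le> (norm ?d)\<^sup>2" "0 \<le> L * (norm ?d)\<^sup>2"
      using L_pos by auto
    ultimately show ?thesis
      unfolding real_norm_def distrib_right by linarith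
  qed
  then show "AE \<omega> in M. norm (global_obj N f (u \<omega>)) \<le> norm (?g \<omega>)"
    by simp
qed

end

section \<open>Second moments of drift, iterates and corrections\<close>

context led_process
begin

text \<open>All moment bounds are kept proportional to this quantity, with no additive constant.
  They therefore vanish when there is no noise and \<open>x0\<close> is stationary for every node,
  the case in which the target bound may be zero.\<close>

definition scale :: real where
  "scale = \<sigma>\<^sup>2 + (\<Sum>i<N. (norm (gradient (f i) x0))\<^sup>2)"

lemma scale_bounds:
  "0 \<le> scale" "\<sigma>\<^sup>2 \<le> scale" "i < N \<Longrightarrow> (norm (gradient (f i) x0))\<^sup>2 \<le> scale"
  using member_le_sum[of i "{..<N}" "\<lambda>i. (norm (gradient (f i) x0))\<^sup>2"]
  by (auto simp: scale_def sum_nonneg add_nonneg_nonneg intro: order_trans add_increasing)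

lemma x_random: "x r \<in> borel_measurable M"
  by (rule measurable_generatedD[OF x_measurable past_steps])

lemma \<phi>_random: "i < N \<Longrightarrow> t \<le> \<tau> \<Longrightarrow> \<phi> i r t \<in> borel_measurable M"
  by (rule measurable_generatedD[OF \<phi>_measurable past_steps])

lemma L2_le_zero: "L2_le M (\<lambda>\<omega>. 0) 0"
  using L2_le_const[of 0] by simp

text \<open>A local step adds a multiple \<alpha> of the stochastic gradient and a correction that
  is itself of order \<alpha>, so the squared drift keeps its factor \<alpha>^2 through the
  induction.\<close>

lemma drift_L2:
  assumes k: "0 \<le> k" and x: "L2_le M (\<lambda>\<omega>. x r \<omega> - x0) (k * scale)"
    and y: "L2_le M (y i r) (\<alpha>\<^sup>2 * (k * scale))" and i: "i < N" and "t \<le> \<tau>"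
  shows "L2_le M (\<lambda>\<omega>. \<phi> i r t \<omega> - x r \<omega>) (\<alpha>\<^sup>2 * (drift_bound L k t * scale))"
  using \<open>t \<le> \<tau>\<close>
proof (induction t)
  case 0
  have "L2_le M (\<lambda>\<omega>. \<phi> i r 0 \<omega> - x r \<omega>) 0 \<longleftrightarrow> L2_le M (\<lambda>\<omega>. 0 :: 'a) 0"
    using i by (intro L2_le_cong) (simp add: run_0)
  then show ?case
    using L2_le_zero by simp
next
  case (Suc t)
  define d where "d = drift_bound L k t"
  have d: "0 \<le> d"
    using k by (simp add: d_def drift_bound_nonneg)
  have t: "t < \<tau>" and \<alpha>1: "\<alpha>\<^sup>2 \<le> 1"
    using Suc.prems \<alpha> by (auto simp: power_le_one)
  have drift: "L2_le M (\<lambda>\<omega>. \<phi> i r t \<omega> - x r \<omega>) (\<alpha>\<^sup>2 * (d * scale))"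
    using Suc by (simp add: d_def)
  have "L2_le M (\<lambda>\<omega>. (\<phi> i r t \<omega> - x r \<omega>) + (x r \<omega> - x0)) (2 * (\<alpha>\<^sup>2 * (d * scale)) + 2 * (k * scale))"
    by (rule L2_le_add[OF drift x])
  \<comment> \<open>The factor \<alpha>^2 is dropped here, so that the recursion for
    \<open>drift_bound\<close> does not involve \<alpha> separately.\<close>
  moreover have "\<alpha>\<^sup>2 * (d * scale) \<le> d * scale"
    using d \<alpha>1 scale_bounds(1) by (intro mult_left_le_one_le) auto
  ultimately have "L2_le M (\<lambda>\<omega>. \<phi> i r t \<omega> - x0) (2 * (d + k) * scale)"
    by (auto elim!: L2_le_mono simp: algebra_simps)
  from gradient_diff_L2[OF i _ _ this] \<phi>_random[OF i, of t r] t
  have "L2_le M (\<lambda>\<omega>. gradient (f i) (\<phi> i r t \<omega>) - gradient (f i) x0) (L\<^sup>2 * (2 * (d + k) * scale))"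
    by simp
  from L2_le_add3[OF err_L2[OF i t, of r] this L2_le_const[of "gradient (f i) x0"]]
  have sg: "L2_le M (sgrad i r t)
      (3 * \<sigma>\<^sup>2 + 3 * (L\<^sup>2 * (2 * (d + k) * scale)) + 3 * (norm (gradient (f i) x0))\<^sup>2)"
    by (simp add: err_def)
  \<comment> \<open>The noise and the gradient at \<open>x0\<close> contribute 3 each to the 6; the
    6 in front of \<open>L\<^sup>2\<close> is the 3 of the threefold split times the 2 from the
    distance to \<open>x0\<close>.\<close>
  have "L2_le M (sgrad i r t) ((6 + 6 * L\<^sup>2 * (d + k)) * scale)"
    by (rule L2_le_mono[OF sg]) (use scale_bounds(2) scale_bounds(3)[OF i] in \<open>simp add: algebra_simps\<close>)
  from L2_le_add3[OF drift L2_le_scaleR[OF this, of "-\<alpha>"] L2_le_scaleR[OF y, of "-1"]]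
  have "L2_le M (\<lambda>\<omega>. \<phi> i r t \<omega> - x r \<omega> + - \<alpha> *\<^sub>R sgrad i r t \<omega> + - 1 *\<^sub>R y i r \<omega>)
      (\<alpha>\<^sup>2 * (drift_bound L k (Suc t) * scale))"
    by (rule L2_le_mono) (simp add: d_def algebra_simps)
  moreover have "L2_le M (\<lambda>\<omega>. \<phi> i r (Suc t) \<omega> - x r \<omega>) c \<longleftrightarrow>
      L2_le M (\<lambda>\<omega>. \<phi> i r t \<omega> - x r \<omega> + - \<alpha> *\<^sub>R sgrad i r t \<omega> + - 1 *\<^sub>R y i r \<omega>) c" for c
    using i t by (intro L2_le_cong) (simp add: run_Suc)
  ultimately show ?case
    by simp
qed

definition moment :: "nat \<Rightarrow> real" where
  "moment = moment_bound L \<tau> (\<gamma> * \<alpha>)"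

lemma moment_nonneg: "0 \<le> moment r"
  by (simp add: moment_def moment_bound_nonneg)

text \<open>Both bounds are carried together, since the drift of a round needs them both. The server
  moves by \<gamma> times the averaged drift, which costs \<open>2 * h\<^sup>2\<close> with
  \<open>h = \<gamma> * \<alpha>\<close>; a correction changes by the drift minus its average, which
  costs 6. The recursion of \<open>moment_bound\<close> covers both.\<close>

lemma moments_L2:
  "L2_le M (\<lambda>\<omega>. x r \<omega> - x0) (moment r * scale) \<and>
   (\<forall>i<N. L2_le M (y i r) (\<alpha>\<^sup>2 * (moment r * scale)))"
proof (induction r)
  case 0
  have "L2_le M (\<lambda>\<omega>. x 0 \<omega> - x0) 0 \<longleftrightarrow> L2_le M (\<lambda>\<omega>. 0 :: 'a) 0"
    by (intro L2_le_cong) (simp add: run_0)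
  moreover have "L2_le M (y i 0) 0 \<longleftrightarrow> L2_le M (\<lambda>\<omega>. 0 :: 'a) 0" if "i < N" for i
    using that by (intro L2_le_cong) (simp add: run_0)
  ultimately show ?case
    by (simp add: moment_def L2_le_zero)
next
  case (Suc r)
  let ?k = "moment r"
  define d where "d = drift_bound L ?k \<tau>"
  have k: "0 \<le> ?k" and d: "0 \<le> d"
    by (simp_all add: d_def drift_bound_nonneg moment_nonneg)
  have \<alpha>1: "\<alpha>\<^sup>2 \<le> 1"
    using \<alpha> by (simp add: power_le_one)
  have next_k: "moment (Suc r) = 3 * ?k + (6 + 2 * (\<gamma> * \<alpha>)\<^sup>2) * d"
    by (simp add: moment_def d_def)
  have drift: "L2_le M (\<lambda>\<omega>. \<phi> i r \<tau> \<omega> - x r \<omega>) (\<alpha>\<^sup>2 * (d * scale))" if "i < N" for i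
    unfolding d_def by (rule drift_L2) (use Suc that moment_nonneg in auto)
  from L2_le_avg[of N M "\<lambda>i \<omega>. \<phi> i r \<tau> \<omega> - x r \<omega>" "\<lambda>_. \<alpha>\<^sup>2 * (d * scale)", OF drift]
  have avg_drift: "L2_le M (\<lambda>\<omega>. avg N (\<lambda>i. \<phi> i r \<tau> \<omega>) - x r \<omega>) (\<alpha>\<^sup>2 * (d * scale))"
    using N by (simp add: avg_diff avg_const)
  have "L2_le M (\<lambda>\<omega>. (x r \<omega> - x0) + \<gamma> *\<^sub>R (avg N (\<lambda>i. \<phi> i r \<tau> \<omega>) - x r \<omega>)) (moment (Suc r) * scale)"
  proof (rule L2_le_mono)
    show "L2_le M (\<lambda>\<omega>. (x r \<omega> - x0) + \<gamma> *\<^sub>R (avg N (\<lambda>i. \<phi> i r \<tau> \<omega>) - x r \<omega>))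
        (2 * (?k * scale) + 2 * (\<gamma>\<^sup>2 * (\<alpha>\<^sup>2 * (d * scale))))"
      using Suc by (intro L2_le_add L2_le_scaleR avg_drift) auto
    have "0 \<le> ?k * scale" "0 \<le> d * scale"
      using k d scale_bounds(1) by auto
    then show "2 * (?k * scale) + 2 * (\<gamma>\<^sup>2 * (\<alpha>\<^sup>2 * (d * scale))) \<le> moment (Suc r) * scale"
      unfolding next_k by (simp add: power_mult_distrib algebra_simps)
  qed
  moreover have "L2_le M (\<lambda>\<omega>. x (Suc r) \<omega> - x0) c \<longleftrightarrow>
      L2_le M (\<lambda>\<omega>. (x r \<omega> - x0) + \<gamma> *\<^sub>R (avg N (\<lambda>i. \<phi> i r \<tau> \<omega>) - x r \<omega>)) c" for c
    by (intro L2_le_cong) (simp add: run_Suc algebra_simps)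
  moreover have "L2_le M (y i (Suc r)) (\<alpha>\<^sup>2 * (moment (Suc r) * scale))" if i: "i < N" for i
  proof -
    have "L2_le M (\<lambda>\<omega>. y i r \<omega> + (\<phi> i r \<tau> \<omega> - x r \<omega>) + - 1 *\<^sub>R (avg N (\<lambda>i. \<phi> i r \<tau> \<omega>) - x r \<omega>))
        (\<alpha>\<^sup>2 * (moment (Suc r) * scale))"
    proof (rule L2_le_mono)
      show "L2_le M (\<lambda>\<omega>. y i r \<omega> + (\<phi> i r \<tau> \<omega> - x r \<omega>) + - 1 *\<^sub>R (avg N (\<lambda>i. \<phi> i r \<tau> \<omega>) - x r \<omega>))
          (3 * (\<alpha>\<^sup>2 * (?k * scale)) + 3 * (\<alpha>\<^sup>2 * (d * scale)) + 3 * ((- 1)\<^sup>2 * (\<alpha>\<^sup>2 * (d * scale))))"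
        using Suc i by (intro L2_le_add3 L2_le_scaleR avg_drift drift) auto
      have "0 \<le> \<alpha>\<^sup>2 * (d * scale) * (\<gamma> * \<alpha>)\<^sup>2"
        using d scale_bounds(1) by auto
      then show "3 * (\<alpha>\<^sup>2 * (?k * scale)) + 3 * (\<alpha>\<^sup>2 * (d * scale)) + 3 * ((- 1)\<^sup>2 * (\<alpha>\<^sup>2 * (d * scale)))
          \<le> \<alpha>\<^sup>2 * (moment (Suc r) * scale)"
        unfolding next_k by (simp add: algebra_simps)
    qed
    moreover have "L2_le M (y i (Suc r)) c \<longleftrightarrow>
        L2_le M (\<lambda>\<omega>. y i r \<omega> + (\<phi> i r \<tau> \<omega> - x r \<omega>) + - 1 *\<^sub>R (avg N (\<lambda>i. \<phi> i r \<tau> \<omega>) - x r \<omega>)) c" for c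
      using i by (intro L2_le_cong) (simp add: run_Suc)
    ultimately show ?thesis
      by simp
  qed
  ultimately show ?case
    by simp
qed

section \<open>Mean gradients, mean errors and the server recursion\<close>

definition drift :: "nat \<Rightarrow> nat \<Rightarrow> real" where
  "drift r t = L\<^sup>2 * (\<alpha>\<^sup>2 * (drift_bound L (moment r) t * scale))"

definition mean_grad :: "nat \<Rightarrow> nat \<Rightarrow> 'w \<Rightarrow> 'a" where
  "mean_grad r t \<omega> = avg N (\<lambda>i. gradient (f i) (\<phi> i r t \<omega>))"

definition mean_err :: "nat \<Rightarrow> 'w \<Rightarrow> 'a" where
  "mean_err r \<omega> = avg \<tau> (\<lambda>t. avg N (\<lambda>i. err i r t \<omega>))"

abbreviation global_grad :: "nat \<Rightarrow> 'w \<Rightarrow> 'a" where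
  "global_grad r \<omega> \<equiv> gradient (global_obj N f) (x r \<omega>)"

lemma mean_grad_drift:
  assumes "t \<le> \<tau>"
  shows "L2_le M (\<lambda>\<omega>. mean_grad r t \<omega> - global_grad r \<omega>) (drift r t)"
proof -
  have "L2_le M (\<lambda>\<omega>. gradient (f i) (\<phi> i r t \<omega>) - gradient (f i) (x r \<omega>)) (drift r t)"
    if "i < N" for i
    unfolding drift_def
    by (intro gradient_diff_L2 drift_L2 \<phi>_random x_random)
      (use that assms moments_L2 moment_nonneg in auto)
  from L2_le_avg[of N M _ "\<lambda>_. drift r t", OF this] show ?thesis
    using N by (simp add: mean_grad_def gradient_global avg_diff avg_const)
qed

text \<open>The size of the bound is irrelevant: it only serves to make the squared norm and the
  inner products with errors integrable.\<close>

lemma global_grad_L2: "\<exists>c. L2_le M (global_grad r) c"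
proof -
  have "\<exists>c. L2_le M (\<lambda>\<omega>. gradient (f i) (x r \<omega>)) c" if "i < N" for i
  proof -
    have "L2_le M (\<lambda>\<omega>. gradient (f i) (x r \<omega>) - gradient (f i) x0) (L\<^sup>2 * (moment r * scale))"
      using moments_L2 that by (intro gradient_diff_L2 x_random) auto
    from L2_le_add[OF this L2_le_const[of "gradient (f i) x0"]] show ?thesis
      by auto
  qed
  then obtain c where "\<And>i. i < N \<Longrightarrow> L2_le M (\<lambda>\<omega>. gradient (f i) (x r \<omega>)) (c i)"
    by metis
  from L2_le_avg[of N M _ c, OF this] show ?thesis
    by (auto simp: gradient_global)
qed

lemma err_pairwise_orthogonal:
  assumes "i < N" "j < N" "t < \<tau>" "s < \<tau>" "(s, j) \<noteq> (t, i)"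
  shows "(\<integral>\<omega>. err j r s \<omega> \<bullet> err i r t \<omega> \<partial>M) = 0"
proof -
  have *: "(\<integral>\<omega>. err j r s \<omega> \<bullet> err i r t \<omega> \<partial>M) = 0"
    if "i < N" "j < N" "t < \<tau>" "s \<le> t" "(s, j) \<noteq> (t, i)" for i j s t
  proof (rule err_orthogonal)
    \<comment> \<open>By symmetry the error at step \<open>s\<close> is not the later one. For
      \<open>s < t\<close> it is determined by the past; for \<open>s = t\<close> it belongs to
      another node, whose current sample has to be adjoined.\<close>
    let ?J = "if s = t then {(j, r, t)} else {}"
    show "?J \<subseteq> steps" "?J \<inter> insert (i, r, t) (past r t) = {}"
      using that by (auto simp: steps_def past_def)
    show "err j r s \<in> borel_measurable (generated (past r t \<union> ?J))"
      by (rule err_measurable) (use that in \<open>auto simp: past_def steps_def\<close>)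
    show "L2_le M (err j r s) (\<sigma>\<^sup>2)"
      using that by (intro err_L2) auto
  qed (use that in auto)
  show ?thesis
  proof (cases "s \<le> t")
    case True
    then show ?thesis
      using assms * by blast
  next
    case False
    then have "(\<integral>\<omega>. err i r t \<omega> \<bullet> err j r s \<omega> \<partial>M) = 0"
      using assms by (intro *) auto
    then show ?thesis
      by (simp add: inner_commute)
  qed
qed

text \<open>A round has \<open>N * \<tau>\<close> pairwise orthogonal errors, and averaging divides
  the second moment of their sum by the square of that number.\<close>

lemma mean_err_L2: "L2_le M (mean_err r) (\<sigma>\<^sup>2 / (real N * real \<tau>))"
proof -
  have "L2_le M (\<lambda>\<omega>. \<Sum>(t, i)\<in>{..<\<tau>} \<times> {..<N}. err i r t \<omega>) (real (card ({..<\<tau>} \<times> {..<N})) * \<sigma>\<^sup>2)"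
    unfolding case_prod_unfold
    by (rule L2_le_sum_orthogonal) (auto intro!: err_L2 err_pairwise_orthogonal)
  from L2_le_scaleR[OF this, of "1 / real \<tau> * (1 / real N)"]
  have "L2_le M (\<lambda>\<omega>. (1 / real \<tau> * (1 / real N)) *\<^sub>R (\<Sum>(t, i)\<in>{..<\<tau>} \<times> {..<N}. err i r t \<omega>))
      (\<sigma>\<^sup>2 / (real N * real \<tau>))"
    by (rule L2_le_mono) (use N \<tau> in \<open>simp add: field_simps power2_eq_square\<close>)
  moreover have "mean_err r
      = (\<lambda>\<omega>. (1 / real \<tau> * (1 / real N)) *\<^sub>R (\<Sum>(t, i)\<in>{..<\<tau>} \<times> {..<N}. err i r t \<omega>))"
    by (auto simp: mean_err_def avg_def scaleR_sum_right[symmetric] sum.cartesian_product)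
  ultimately show ?thesis
    by simp
qed

text \<open>The server iterate is fixed before the first local step, so it lies in the past of every
  error of the round and no samples need to be adjoined.\<close>

lemma mean_err_orthogonal: "(\<integral>\<omega>. global_grad r \<omega> \<bullet> mean_err r \<omega> \<partial>M) = 0"
proof -
  obtain c where c: "L2_le M (global_grad r) c"
    using global_grad_L2 by blast
  have zero: "(\<integral>\<omega>. global_grad r \<omega> \<bullet> err i r t \<omega> \<partial>M) = 0" if "i < N" "t < \<tau>" for i t
  proof (rule err_orthogonal[where J = "{}"])
    have "x r \<in> borel_measurable (generated (past r t))"
      using x_measurable by (rule measurable_generated_mono) (rule past_mono, simp)
    then show "global_grad r \<in> borel_measurable (generated (past r t \<union> {}))"
      by simp
  qed (use that c in auto)
  have int: "integrable M (\<lambda>\<omega>. global_grad r \<omega> \<bullet> err i r t \<omega>)" if "i < N" "t < \<tau>" for i t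
    using that by (intro L2_le_integrable_inner[OF c err_L2])
  have "global_grad r \<omega> \<bullet> mean_err r \<omega>
      = avg \<tau> (\<lambda>t. avg N (\<lambda>i. global_grad r \<omega> \<bullet> err i r t \<omega>))" for \<omega>
    by (simp add: mean_err_def avg_def inner_sum_right)
  moreover have "integrable M (\<lambda>\<omega>. avg N (\<lambda>i. global_grad r \<omega> \<bullet> err i r t \<omega>))" if "t < \<tau>" for t
    unfolding avg_def real_scaleR_def using that
    by (intro integrable_mult_right Bochner_Integration.integrable_sum int) auto
  moreover have "(\<integral>\<omega>. avg N (\<lambda>i. global_grad r \<omega> \<bullet> err i r t \<omega>) \<partial>M) = 0" if "t < \<tau>" for t
    using that by (simp add: avg_def int zero)
  ultimately show ?thesis
    by (simp add: avg_def[of \<tau>])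
qed

text \<open>Each correction is increased by a deviation from an average, and such deviations sum to
  zero. This removes the corrections from the server recursion.\<close>

lemma avg_y: "\<omega> \<in> space M \<Longrightarrow> avg N (\<lambda>i. y i r \<omega>) = 0"
proof (induction r)
  case 0
  then show ?case
    by (simp add: avg_def run_0)
next
  case (Suc r)
  have "avg N (\<lambda>i. y i (Suc r) \<omega>)
      = avg N (\<lambda>i. y i r \<omega> + \<phi> i r \<tau> \<omega> - avg N (\<lambda>j. \<phi> j r \<tau> \<omega>))"
    using Suc.prems by (intro avg_cong) (simp add: run_Suc)
  then show ?case
    using N Suc by (simp add: avg_diff avg_add avg_const)
qed

lemma local_steps:
  assumes "\<omega> \<in> space M" "i < N" "t \<le> \<tau>"
  shows "\<phi> i r t \<omega> = x r \<omega> - \<alpha> *\<^sub>R (\<Sum>s<t. sgrad i r s \<omega>) - real t *\<^sub>R y i r \<omega>"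
  using assms(3)
proof (induction t)
  case 0
  then show ?case
    using assms by (simp add: run_0)
next
  case (Suc t)
  then show ?case
    using assms by (simp add: run_Suc algebra_simps)
qed

lemma x_step:
  assumes \<omega>: "\<omega> \<in> space M"
  shows "x (Suc r) \<omega>
    = x r \<omega> - (\<gamma> * \<alpha> * real \<tau>) *\<^sub>R (avg \<tau> (\<lambda>t. mean_grad r t \<omega>) + mean_err r \<omega>)"
proof -
  have "avg N (\<lambda>i. \<phi> i r \<tau> \<omega>)
      = avg N (\<lambda>i. x r \<omega> - (\<alpha> * real \<tau>) *\<^sub>R avg \<tau> (\<lambda>t. sgrad i r t \<omega>) - real \<tau> *\<^sub>R y i r \<omega>)"
    using \<omega> \<tau> by (intro avg_cong) (simp add: local_steps avg_def)
  also have "\<dots> = x r \<omega> - (\<alpha> * real \<tau>) *\<^sub>R avg \<tau> (\<lambda>t. avg N (\<lambda>i. sgrad i r t \<omega>))"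
    using \<omega> N by (simp add: avg_diff avg_const avg_scaleR avg_y avg_swap[of N \<tau>])
  also have "avg \<tau> (\<lambda>t. avg N (\<lambda>i. sgrad i r t \<omega>)) = avg \<tau> (\<lambda>t. mean_grad r t \<omega>) + mean_err r \<omega>"
    by (simp add: mean_grad_def mean_err_def avg_add[symmetric] err_def)
  finally have eq: "avg N (\<lambda>i. \<phi> i r \<tau> \<omega>)
      = x r \<omega> - (\<alpha> * real \<tau>) *\<^sub>R (avg \<tau> (\<lambda>t. mean_grad r t \<omega>) + mean_err r \<omega>)" .
  show ?thesis
    unfolding run_Suc(2)[OF \<omega>] eq by (simp add: algebra_simps)
qed

section \<open>Expected descent and the averaged error\<close>

definition mean_drift :: "nat \<Rightarrow> real" where
  "mean_drift r = avg \<tau> (drift r)"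

text \<open>The pointwise inequality is integrated for the step size at which \<open>x_step\<close>
  moves the server. Its linear error term disappears by orthogonality, leaving only the drift and
  the variance.\<close>

lemma expected_descent:
  defines "\<eta> \<equiv> \<gamma> * \<alpha> * real \<tau>"
  assumes \<eta>: "\<eta> \<le> 1 / (2 * L)"
  shows "(\<integral>\<omega>. global_obj N f (x (Suc r) \<omega>) \<partial>M) \<le> (\<integral>\<omega>. global_obj N f (x r \<omega>) \<partial>M)
    - \<eta> / 2 * (\<integral>\<omega>. (norm (global_grad r \<omega>))\<^sup>2 \<partial>M) + \<eta> / 2 * mean_drift r
    + L * \<eta>\<^sup>2 * (\<sigma>\<^sup>2 / (real N * real \<tau>))"
proof -
  have \<eta>0: "0 \<le> \<eta>"
    using \<alpha> \<gamma> by (simp add: \<eta>_def)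
  let ?g = "\<lambda>\<omega>. avg \<tau> (\<lambda>t. mean_grad r t \<omega>)"
  obtain c where c: "L2_le M (global_grad r) c"
    using global_grad_L2 by blast
  have g: "L2_le M (\<lambda>\<omega>. ?g \<omega> - global_grad r \<omega>) (mean_drift r)"
    using L2_le_avg[of \<tau> M "\<lambda>t \<omega>. mean_grad r t \<omega> - global_grad r \<omega>" "drift r", OF mean_grad_drift] \<tau>
    by (simp add: avg_diff avg_const mean_drift_def)
  have f_int: "integrable M (\<lambda>\<omega>. global_obj N f (x q \<omega>))" for q
    using moments_L2[of q] by (intro global_integrable[OF prob_space_axioms x_random]) blast
  note ints = f_int L2_leD(2)[OF c] L2_leD(2)[OF g] L2_leD(2)[OF mean_err_L2[of r]]
    L2_le_integrable_inner[OF c mean_err_L2[of r]]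
  have "(\<integral>\<omega>. global_obj N f (x (Suc r) \<omega>) \<partial>M)
      \<le> (\<integral>\<omega>. global_obj N f (x r \<omega>) - \<eta> / 2 * (norm (global_grad r \<omega>))\<^sup>2
          + \<eta> / 2 * (norm (?g \<omega> - global_grad r \<omega>))\<^sup>2
          - \<eta> * (global_grad r \<omega> \<bullet> mean_err r \<omega>) + L * \<eta>\<^sup>2 * (norm (mean_err r \<omega>))\<^sup>2 \<partial>M)"
  proof (rule integral_mono)
    show "integrable M (\<lambda>\<omega>. global_obj N f (x r \<omega>) - \<eta> / 2 * (norm (global_grad r \<omega>))\<^sup>2
          + \<eta> / 2 * (norm (?g \<omega> - global_grad r \<omega>))\<^sup>2
          - \<eta> * (global_grad r \<omega> \<bullet> mean_err r \<omega>) + L * \<eta>\<^sup>2 * (norm (mean_err r \<omega>))\<^sup>2)"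
      by (intro Bochner_Integration.integrable_add Bochner_Integration.integrable_diff
          integrable_mult_right ints)
    fix \<omega>
    assume \<omega>: "\<omega> \<in> space M"
    show "global_obj N f (x (Suc r) \<omega>)
        \<le> global_obj N f (x r \<omega>) - \<eta> / 2 * (norm (global_grad r \<omega>))\<^sup>2
          + \<eta> / 2 * (norm (?g \<omega> - global_grad r \<omega>))\<^sup>2
          - \<eta> * (global_grad r \<omega> \<bullet> mean_err r \<omega>) + L * \<eta>\<^sup>2 * (norm (mean_err r \<omega>))\<^sup>2"
      unfolding x_step[OF \<omega>] \<eta>_def[symmetric] by (rule descent_pointwise[OF \<eta>0 \<eta>])
  qed (rule f_int)
  also have "\<dots> = (\<integral>\<omega>. global_obj N f (x r \<omega>) \<partial>M) - \<eta> / 2 * (\<integral>\<omega>. (norm (global_grad r \<omega>))\<^sup>2 \<partial>M)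
      + \<eta> / 2 * (\<integral>\<omega>. (norm (?g \<omega> - global_grad r \<omega>))\<^sup>2 \<partial>M)
      + L * \<eta>\<^sup>2 * (\<integral>\<omega>. (norm (mean_err r \<omega>))\<^sup>2 \<partial>M)"
    using ints mean_err_orthogonal[of r] by simp
  also have "\<dots> \<le> (\<integral>\<omega>. global_obj N f (x r \<omega>) \<partial>M) - \<eta> / 2 * (\<integral>\<omega>. (norm (global_grad r \<omega>))\<^sup>2 \<partial>M)
      + \<eta> / 2 * mean_drift r + L * \<eta>\<^sup>2 * (\<sigma>\<^sup>2 / (real N * real \<tau>))"
    using L2_leD(3)[OF g] L2_leD(3)[OF mean_err_L2[of r]] \<eta>0 L_pos
    by (intro add_mono mult_left_mono) auto
  finally show ?thesis .
qed

lemma led_error_le: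
  "led_error M N \<tau> f x \<phi> r \<le> 3 * (\<integral>\<omega>. (norm (global_grad r \<omega>))\<^sup>2 \<partial>M) + 2 * mean_drift r"
proof -
  let ?E = "\<integral>\<omega>. (norm (global_grad r \<omega>))\<^sup>2 \<partial>M"
  obtain c where "L2_le M (global_grad r) c"
    using global_grad_L2 by blast
  \<comment> \<open>Once some bound is known to exist, the second moment itself may serve as the
    bound.\<close>
  then have c: "L2_le M (global_grad r) ?E"
    by (simp add: L2_le_def)
  have "(\<integral>\<omega>. (norm (mean_grad r t \<omega>))\<^sup>2 \<partial>M) \<le> 2 * ?E + 2 * drift r t" if "t < \<tau>" for t
    using L2_le_add[OF c mean_grad_drift[of t r]] that by (simp add: L2_le_def)
  then have "avg \<tau> (\<lambda>t. \<integral>\<omega>. (norm (mean_grad r t \<omega>))\<^sup>2 \<partial>M) \<le> avg \<tau> (\<lambda>t. 2 * ?E + 2 * drift r t)"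
    by (rule avg_mono)
  also have "\<dots> = 2 * ?E + 2 * mean_drift r"
    using \<tau> avg_scaleR[of \<tau> 2 "drift r"] by (simp add: avg_add avg_const mean_drift_def)
  finally show ?thesis
    by (simp add: led_error_def avg_def mean_grad_def)
qed

lemma mean_led_error_le:
  defines "\<eta> \<equiv> \<gamma> * \<alpha> * real \<tau>"
  assumes \<eta>: "\<eta> \<le> 1 / (2 * L)" and R: "R \<ge> 1"
  shows "(1 / real R) * (\<Sum>r<R. led_error M N \<tau> f x \<phi> r)
    \<le> 6 * (global_obj N f x0 - (INF v. global_obj N f v)) / (\<eta> * real R)
      + 5 * avg R mean_drift + 6 * L * \<eta> * (\<sigma>\<^sup>2 / (real N * real \<tau>))"
proof -
  have \<eta>0: "0 < \<eta>"
    using \<alpha> \<gamma> \<tau> by (simp add: \<eta>_def)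
  let ?E = "\<lambda>r. \<integral>\<omega>. (norm (global_grad r \<omega>))\<^sup>2 \<partial>M"
  let ?f = "\<lambda>r. \<integral>\<omega>. global_obj N f (x r \<omega>) \<partial>M"
  let ?v = "\<sigma>\<^sup>2 / (real N * real \<tau>)" and ?m = "INF v. global_obj N f v"
  have f_int: "integrable M (\<lambda>\<omega>. global_obj N f (x q \<omega>))" for q
    using moments_L2[of q] by (intro global_integrable[OF prob_space_axioms x_random]) blast
  have step: "\<eta> / 2 * ?E r \<le> ?f r - ?f (Suc r) + \<eta> / 2 * mean_drift r + L * \<eta>\<^sup>2 * ?v" for r
    using expected_descent[of r, folded \<eta>_def, OF \<eta>] by linarith
  have "\<eta> / 2 * (\<Sum>r<R. ?E r)
      \<le> (\<Sum>r<R. ?f r - ?f (Suc r) + \<eta> / 2 * mean_drift r + L * \<eta>\<^sup>2 * ?v)"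
    unfolding sum_distrib_left by (intro sum_mono step)
  also have "\<dots> = ?f 0 - ?f R + \<eta> / 2 * (\<Sum>r<R. mean_drift r) + real R * (L * \<eta>\<^sup>2 * ?v)"
    by (simp add: sum.distrib sum_lessThan_telescope'[of ?f R] sum_distrib_left)
  also have "?f 0 = (\<integral>\<omega>. global_obj N f x0 \<partial>M)"
    by (intro Bochner_Integration.integral_cong refl) (simp add: run_0)
  also have "\<dots> = global_obj N f x0"
    by (simp add: prob_space)
  finally have "\<eta> / 2 * (\<Sum>r<R. ?E r) \<le> global_obj N f x0 - ?f R
      + \<eta> / 2 * (\<Sum>r<R. mean_drift r) + real R * (L * \<eta>\<^sup>2 * ?v)" .
  moreover have "?m \<le> ?f R"
    using integral_mono[of M "\<lambda>_. ?m", OF _ f_int global_lower_bound] by (simp add: prob_space)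
  ultimately have sum_E: "\<eta> / 2 * (\<Sum>r<R. ?E r)
      \<le> global_obj N f x0 - ?m + \<eta> / 2 * (\<Sum>r<R. mean_drift r) + real R * (L * \<eta>\<^sup>2 * ?v)"
    by simp
  have "\<eta> * (\<Sum>r<R. led_error M N \<tau> f x \<phi> r)
      \<le> \<eta> * (\<Sum>r<R. 3 * ?E r + 2 * mean_drift r)"
    using \<eta>0 by (intro mult_left_mono sum_mono led_error_le) auto
  also have "\<dots> = 6 * (\<eta> / 2 * (\<Sum>r<R. ?E r)) + 2 * \<eta> * (\<Sum>r<R. mean_drift r)"
    by (simp add: sum.distrib sum_distrib_left[symmetric] algebra_simps)
  \<comment> \<open>The 5 combines 6 times the half from the descent inequality with the 2 from
    \<open>led_error_le\<close>.\<close>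
  also have "\<dots> \<le> 6 * (global_obj N f x0 - ?m) + 5 * \<eta> * (\<Sum>r<R. mean_drift r)
      + 6 * real R * (L * \<eta>\<^sup>2 * ?v)"
    using sum_E by simp
  finally have "\<eta> * (\<Sum>r<R. led_error M N \<tau> f x \<phi> r) / (\<eta> * real R)
      \<le> (6 * (global_obj N f x0 - ?m) + 5 * \<eta> * (\<Sum>r<R. mean_drift r)
          + 6 * real R * (L * \<eta>\<^sup>2 * ?v)) / (\<eta> * real R)"
    using \<eta>0 by (intro divide_right_mono) auto
  then show ?thesis
    using \<eta>0 R by (simp add: avg_def add_divide_distrib power2_eq_square)
qed

end

section \<open>Choice of the parameters\<close>

text \<open>With \<open>a = \<sigma> / sqrt (n * R)\<close>, the first term is
  \<open>12 * L * (\<Delta> / R) + 6 * \<Delta> * a\<close> and the last is at most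
  \<open>6 * L * a\<close>. The product of \<Delta> and \<open>a\<close> is why the constant depends
  on the initial gap.\<close>

lemma rate_arithmetic:
  fixes L \<Delta> \<sigma> n R :: real
  assumes pos: "0 < L" "0 \<le> \<Delta>" "0 \<le> \<sigma>" "0 < n" "0 < R"
    and \<eta>: "\<eta> = 1 / (2 * L + \<sigma> * sqrt (R / n))"
    and Q: "\<sigma> / sqrt (n * R) + \<Delta> / R \<le> Q"
  shows "6 * \<Delta> / (\<eta> * R) + Q + 6 * L * \<eta> * (\<sigma>\<^sup>2 / n) \<le> rate_const L \<Delta> * Q"
proof -
  define a where "a = \<sigma> / sqrt (n * R)"
  have den: "0 < 2 * L + \<sigma> * sqrt (R / n)"
    using pos by (intro add_pos_nonneg mult_pos_pos mult_nonneg_nonneg) auto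
  have a0: "0 \<le> a" and aQ: "a \<le> Q" and \<Delta>Q: "\<Delta> / R \<le> Q"
    using pos Q by (auto simp: a_def intro: order_trans[rotated])
  have Q0: "0 \<le> Q"
    using a0 aQ by simp
  have s1: "sqrt (R / n) / R = 1 / sqrt (n * R)"
  proof -
    have "sqrt (R / n) / R = sqrt R / (sqrt n * (sqrt R * sqrt R))"
      using pos by (simp add: real_sqrt_divide)
    then show ?thesis
      using pos by (simp add: real_sqrt_mult field_simps)
  qed
  have s2: "sqrt (R / n) / sqrt (n * R) = 1 / n"
    using pos by (simp add: real_sqrt_divide real_sqrt_mult field_simps)
  have "6 * \<Delta> / (\<eta> * R) = 6 * \<Delta> * (2 * L + \<sigma> * sqrt (R / n)) / R"
    using den by (simp add: \<eta>)
  also have "\<dots> = 12 * L * (\<Delta> / R) + 6 * \<Delta> * (\<sigma> * (sqrt (R / n) / R))"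
    by (simp add: distrib_left add_divide_distrib)
  also have "\<dots> = 12 * L * (\<Delta> / R) + 6 * \<Delta> * a"
    by (simp only: s1) (simp add: a_def)
  finally have t1: "6 * \<Delta> / (\<eta> * R) = 12 * L * (\<Delta> / R) + 6 * \<Delta> * a" .
  \<comment> \<open>The variance is \<open>a\<close> times the second summand of the reciprocal step
    size, so multiplication by \<eta> leaves at most \<open>a\<close>.\<close>
  have "\<sigma>\<^sup>2 / n = \<sigma> * \<sigma> * (sqrt (R / n) / sqrt (n * R))"
    by (simp only: s2) (simp add: power2_eq_square)
  also have "\<dots> = a * (\<sigma> * sqrt (R / n))"
    by (simp add: a_def)
  also have "\<dots> \<le> a * (2 * L + \<sigma> * sqrt (R / n))"
    using a0 pos by (intro mult_left_mono) auto
  finally have "(\<sigma>\<^sup>2 / n) / (2 * L + \<sigma> * sqrt (R / n)) \<le> a"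
    using den by (subst pos_divide_le_eq)
  then have t2: "\<eta> * (\<sigma>\<^sup>2 / n) \<le> a"
    by (simp add: \<eta> mult.commute)
  have "6 * L * \<eta> * (\<sigma>\<^sup>2 / n) \<le> 6 * L * a"
    using mult_left_mono[OF t2, of "6 * L"] pos by (simp add: mult.assoc)
  moreover have "12 * L * (\<Delta> / R) \<le> 12 * L * Q"
    using \<Delta>Q pos by (intro mult_left_mono) auto
  moreover have "6 * \<Delta> * a \<le> 6 * \<Delta> * Q" "6 * L * a \<le> 6 * L * Q"
    using aQ pos by (intro mult_left_mono; simp)+
  moreover have "rate_const L \<Delta> * Q = 100 * Q + 100 * L * Q + 100 * \<Delta> * Q + 100 * L * \<Delta> * Q"
    by (simp add: rate_const_def algebra_simps)
  moreover have "0 \<le> L * Q" "0 \<le> \<Delta> * Q" "0 \<le> L * \<Delta> * Q"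
    using pos Q0 by auto
  ultimately show ?thesis
    using Q0 unfolding t1 by linarith
qed

theorem corollary3:
  fixes N \<tau> R :: nat and L \<sigma> \<Delta> :: real
    and D :: "nat \<Rightarrow> 's measure"
    and F :: "nat \<Rightarrow> real ^ 'm \<Rightarrow> 's \<Rightarrow> real"
    and f :: "nat \<Rightarrow> real ^ 'm \<Rightarrow> real"
    and x0 :: "real ^ 'm"
  assumes "N \<ge> 1" and "\<tau> \<ge> 1" and "R \<ge> 1" and "\<sigma> \<ge> 0"
    and "stochastic_objectives N D F f"
    and "smooth_objectives N L f"
    and "\<Delta> = global_obj N f x0 - (INF v. global_obj N f v)"
  shows "\<exists>\<alpha>>0. \<exists>\<beta>>0. \<exists>\<gamma>>0.
    \<forall>(M :: 'w measure) \<xi> x y \<phi>.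
      prob_space M \<longrightarrow>
      led_run M N \<tau> \<alpha> \<beta> \<gamma> x0 F \<xi> x y \<phi> \<longrightarrow>
      noise_assumption M N \<tau> \<sigma> D F f \<xi> \<phi> \<longrightarrow>
      (1 / real R) * (\<Sum>r<R. led_error M N \<tau> f x \<phi> r)
        \<le> rate_const L \<Delta> *
            (\<sigma> / sqrt (real N * real R * real \<tau>) + (\<Delta> + heterogeneity N f x0) / real R)"
proof -
  interpret smooth_sum N L f
    using assms by unfold_locales
  define n where "n = real N * real \<tau>"
  have n: "0 < n"
    using assms by (simp add: n_def)
  let ?H = "heterogeneity N f x0"
  define Q where "Q = \<sigma> / sqrt (n * real R) + (\<Delta> + ?H) / real R"
  define \<eta> where "\<eta> = 1 / (2 * L + \<sigma> * sqrt (real R / n))"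
  \<comment> \<open>Fixing the product of \<gamma> and \<alpha> first avoids a circular choice:
    \<open>C\<close> depends on \<open>h\<close> but not on \<alpha>, so \<alpha> can be chosen
    after \<open>C\<close>, and \<gamma> is recovered as \<open>h / \<alpha>\<close>.\<close>
  define h where "h = \<eta> / real \<tau>"
  define S where "S = \<sigma>\<^sup>2 + (\<Sum>i<N. (norm (gradient (f i) x0))\<^sup>2)"
  define C where
    "C = 5 * avg R (\<lambda>r. avg \<tau> (\<lambda>t. L\<^sup>2 * (drift_bound L (moment_bound L \<tau> h r) t * S)))"
  have den: "0 < 2 * L + \<sigma> * sqrt (real R / n)" "2 * L \<le> 2 * L + \<sigma> * sqrt (real R / n)"
    using L_pos \<open>\<sigma> \<ge> 0\<close> n by (auto intro!: add_pos_nonneg)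
  have \<eta>: "0 < \<eta>" "\<eta> \<le> 1 / (2 * L)"
    using den L_pos by (auto simp: \<eta>_def intro!: divide_left_mono)
  have \<Delta>: "0 \<le> \<Delta>"
    using global_lower_bound[of x0] assms by simp
  have H: "0 \<le> ?H"
    by (auto simp: heterogeneity_def avg_def intro!: divide_nonneg_nonneg sum_nonneg)
  have S: "0 \<le> S"
    by (auto simp: S_def intro!: add_nonneg_nonneg sum_nonneg)
  have Q: "0 \<le> Q"
    using \<open>\<sigma> \<ge> 0\<close> \<Delta> H n by (simp add: Q_def)
  have S_0: "S = 0" if "Q = 0"
  proof -
    have "\<sigma> / sqrt (n * real R) = 0" "(\<Delta> + ?H) / real R = 0"
      using that \<open>\<sigma> \<ge> 0\<close> \<Delta> H n by (simp_all add: Q_def add_nonneg_eq_0_iff)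
    then have 0: "\<sigma> = 0" "\<Delta> = 0" "?H = 0"
      using n \<open>R \<ge> 1\<close> \<Delta> H by (auto simp: add_nonneg_eq_0_iff)
    \<comment> \<open>A zero gap makes \<open>x0\<close> a global minimiser, so the global gradient
      vanishes there and zero heterogeneity forces every local gradient to vanish as well.\<close>
    have "global_obj N f x0 \<le> global_obj N f v" for v
      using global_lower_bound[of v] assms 0 by simp
    then have "gradient (global_obj N f) x0 = 0"
      by (intro gradient_eq_0_of_minimum differentiable_global)
    then have "(\<Sum>i<N. (norm (gradient (f i) x0))\<^sup>2) = 0"
      using 0 assms(1) by (simp add: heterogeneity_def avg_def)
    then show ?thesis
      using 0 by (simp add: S_def)
  qed
  obtain \<alpha> where \<alpha>_small: "0 < \<alpha>" "\<alpha> \<le> 1" "\<alpha>\<^sup>2 * C \<le> Q"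
  proof (cases "Q = 0")
    case True
    then have "C = 0"
      using S_0 by (simp add: C_def avg_def)
    then show ?thesis
      using that[of 1] Q by simp
  next
    case False
    then have "0 < Q"
      using Q by simp
    have C: "0 \<le> C"
      using S moment_bound_nonneg[of L \<tau> h]
      by (auto simp: C_def avg_def drift_bound_nonneg
          intro!: divide_nonneg_nonneg sum_nonneg mult_nonneg_nonneg)
    \<comment> \<open>Adding 1 to \<open>C\<close> keeps the quotient defined when \<open>C\<close>
      is zero, and the cap at 1 gives \<open>a\<^sup>2 \<le> a\<close>.\<close>
    define a where "a = min 1 (Q / (C + 1))"
    have a: "0 < a" "a \<le> 1" "a \<le> Q / (C + 1)"
      using \<open>0 < Q\<close> C by (auto simp: a_def)
    have "a\<^sup>2 * C \<le> a * (C + 1)"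
      using a C by (intro mult_mono) (auto simp: power2_eq_square mult_left_le)
    also have "\<dots> \<le> Q"
      using a(3) C by (simp add: pos_le_divide_eq)
    finally show ?thesis
      using that a by blast
  qed
  define \<gamma> where "\<gamma> = h / \<alpha>"
  have \<gamma>_eq: "0 < \<gamma>" "\<gamma> * \<alpha> = h" "\<gamma> * \<alpha> * real \<tau> = \<eta>"
    using \<alpha>_small \<eta> assms(2) by (auto simp: \<gamma>_def h_def)
  have "(1 / real R) * (\<Sum>r<R. led_error M N \<tau> f x \<phi> r) \<le> rate_const L \<Delta> * Q"
    if "prob_space M" "led_run M N \<tau> \<alpha> 1 \<gamma> x0 F \<xi> x y \<phi>" "noise_assumption M N \<tau> \<sigma> D F f \<xi> \<phi>"
    for M :: "'w measure" and \<xi> x y \<phi>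
  proof -
    interpret prob_space M
      by fact
    interpret led_process M N L f \<tau> \<alpha> \<gamma> \<sigma> D F x0 \<xi> x y \<phi>
      using that assms \<alpha>_small \<gamma>_eq by unfold_locales
    \<comment> \<open>\<open>C\<close> is the drift contribution to the averaged error with
      \<alpha>^2 factored out.\<close>
    have "5 * avg R mean_drift = \<alpha>\<^sup>2 * C"
      unfolding C_def mean_drift_def drift_def moment_def scale_def S_def[symmetric] \<gamma>_eq(2)[symmetric]
      by (simp add: avg_def sum_distrib_left sum_divide_distrib mult_ac)
    then have drift: "5 * avg R mean_drift \<le> Q"
      using \<alpha>_small by simp
    have "(1 / real R) * (\<Sum>r<R. led_error M N \<tau> f x \<phi> r)
        \<le> 6 * \<Delta> / (\<eta> * real R) + 5 * avg R mean_drift + 6 * L * \<eta> * (\<sigma>\<^sup>2 / n)"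
      using mean_led_error_le[of R, unfolded \<gamma>_eq(3), OF \<eta>(2) assms(3)]
      unfolding assms(7) n_def .
    also have "\<dots> \<le> 6 * \<Delta> / (\<eta> * real R) + Q + 6 * L * \<eta> * (\<sigma>\<^sup>2 / n)"
      using drift by simp
    also have "\<dots> \<le> rate_const L \<Delta> * Q"
    proof (rule rate_arithmetic)
      show "\<sigma> / sqrt (n * real R) + \<Delta> / real R \<le> Q"
        using H by (simp add: Q_def add_divide_distrib)
    qed (use L_pos \<Delta> assms n \<eta>_def in auto)
    finally show ?thesis .
  qed
  then show ?thesis
    using \<alpha>_small \<gamma>_eq
    by (intro exI[of _ \<alpha>] exI[of _ 1] exI[of _ \<gamma>] conjI) (auto simp: Q_def n_def mult_ac)
qed

end
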